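(* Let $M,N,H\ge 1$ and $0\le H_0\le H$ be integers, let $\phi_U,\theta_U,\phi_V,\theta_V>0$, let $U_0\in \mathrm{M}(M,H_0,K_0)$, $V_0\in \mathrm{M}(H_0,N,K_0)$, where $H_0$ is the non-negative rank of $U_0V_0$, and let the prior be the gamma prior $\varphi(U,V)=\mathrm{Gam}(U|\phi_U,\theta_U)\,\mathrm{Gam}(V|\phi_V,\theta_V)$. Then the RLCT of NMF $\lambda$ satisfies $$\lambda \le \frac{1}{2}\left[(H-H_0)\min\{M\phi_U,N\phi_V\}+H_0(M+N-1)\right].$$ The equality holds if $H=H_0=1$.
   Context: $\mathrm{M}(M,N,C)$ denotes the set of $M\times N$ matrices with entries in $C\subset\mathbb{R}$. $K$ is a compact subset of $\mathbb{R}_{\ge 0}$ and $K_0$ is a compact subset of $\mathbb{R}_{>0}$, such that $\{(x,y,a,b)\in K^2\times K_0^2 : xy=ab\}\neq\emptyset$. The parameters are $U=(u_{ik})\in \mathrm{M}(M,H,K)$ and $V=(v_{kj})\in \mathrm{M}(H,N,K)$. The non-negative rank of a non-negative $M\times N$ matrix $A$ is the smallest $r$ such that $A=BC$ with entrywise non-negative matrices $B$ ($M\times r$) and $C$ ($r\times N$); when $H_0=0$, $U_0V_0$ means the zero matrix. The gamma densities are $$\mathrm{Gam}(U|\phi_U,\theta_U)=\prod_{i=1}^M\prod_{k=1}^H\frac{\theta_U^{\phi_U}}{\Gamma(\phi_U)}u_{ik}^{\phi_U-1}e^{-\theta_U u_{ik}},\qquad \mathrm{Gam}(V|\phi_V,\theta_V)=\prod_{k=1}^H\prod_{j=1}^N\frac{\theta_V^{\phi_V}}{\Gamma(\phi_V)}v_{kj}^{\phi_V-1}e^{-\theta_V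 v_{kj}}.$$ RLCT (real log canonical threshold) of NMF (non-negative matrix factorization): with $\|\cdot\|$ the Frobenius norm, consider the function of one complex variable $$\zeta(z)=\int_{\mathrm{M}(M,H,K)}dU\int_{\mathrm{M}(H,N,K)}dV\,\left(\|UV-U_0V_0\|^2\right)^z\varphi(U,V),$$ holomorphic for $\mathrm{Re}(z)>0$ and analytically continued to a meromorphic function on $\mathbb{C}$. If its largest pole is equal to $-\lambda$, then $\lambda$ is called the RLCT of NMF.
   Formalization: False for arbitrary compact K (e.g. M=N=H=H_0=1, K=[2,3], U_0=V_0=2). Added: U_0V_0 also factors as U_1V_1, of the same sizes, with entries in the interior of K; and, if H_0<H, K contains an interval [0,ε] with ε>0. *)

theory Defs
  imports "HOL-Complex_Analysis.Complex_Analysis" "Jordan_Normal_Form.Matrix"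
begin

(* Matrices are those of Jordan_Normal_Form; HOL-Analysis uses clashing names for its own. *)
hide_const (open) Finite_Cartesian_Product.mat Finite_Cartesian_Product.row
  Finite_Cartesian_Product.column Finite_Cartesian_Product.vec
hide_type (open) Finite_Cartesian_Product.vec

definition mats :: "nat \<Rightarrow> nat \<Rightarrow> 'a set \<Rightarrow> 'a mat set" where
  "mats m n C = {A \<in> carrier_mat m n. elements_mat A \<subseteq> C}"

definition nonneg_rank :: "real mat \<Rightarrow> nat" where
  "nonneg_rank A = (LEAST r. \<exists>B \<in> mats (dim_row A) r {0..}. \<exists>C \<in> mats r (dim_col A) {0..}. A = B * C)"

definition frobenius_norm :: "real mat \<Rightarrow> real" where
  "frobenius_norm A = sqrt (\<Sum>i<dim_row A. \<Sum>j<dim_col A. (A $$ (i, j))\<^sup>2)"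

(* Lebesgue measure on the m x n real matrices: the product measure on the entries,
   transported along Matrix.mat, which is injective on extensional functions. *)
definition lborel_mat :: "nat \<Rightarrow> nat \<Rightarrow> real mat measure" where
  "lborel_mat m n =
     embed_measure (Pi\<^sub>M ({..<m} \<times> {..<n}) (\<lambda>_. lborel)) (Matrix.mat m n)"

(* Since 0 powr a = 0, the value at a matrix with a zero entry is 0, whatever phi is;
   such matrices form a null set. *)
definition Gam :: "real mat \<Rightarrow> real \<Rightarrow> real \<Rightarrow> real" where
  "Gam A \<phi> \<theta> = (\<Prod>i<dim_row A. \<Prod>k<dim_col A.
     \<theta> powr \<phi> / Gamma \<phi> * (A $$ (i, k)) powr (\<phi> - 1) * exp (- \<theta> * A $$ (i, k)))"

definition gamma_prior :: "real \<Rightarrow> real \<Rightarrow> real \<Rightarrow> real \<Rightarrow> real mat \<Rightarrow> real mat \<Rightarrow> real" where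
  "gamma_prior \<phi>\<^sub>U \<theta>\<^sub>U \<phi>\<^sub>V \<theta>\<^sub>V U V = Gam U \<phi>\<^sub>U \<theta>\<^sub>U * Gam V \<phi>\<^sub>V \<theta>\<^sub>V"

(* W is the true matrix U0 * V0.  Only the values at Re z > 0 are meaningful. *)
definition nmf_zeta ::
  "nat \<Rightarrow> nat \<Rightarrow> nat \<Rightarrow> real set \<Rightarrow> real mat \<Rightarrow> (real mat \<Rightarrow> real mat \<Rightarrow> real) \<Rightarrow> complex \<Rightarrow> complex" where
  "nmf_zeta M N H K W \<phi> z =
     (LINT U : mats M H K | lborel_mat M H. (LINT V : mats H N K | lborel_mat H N.
        complex_of_real ((frobenius_norm (U * V - W))\<^sup>2) powr z * complex_of_real (\<phi> U V)))"

(* -l is the largest pole of the meromorphic continuation Z of a zeta function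
   that is given on the half-plane Re z > 0. *)
definition is_rlct :: "(complex \<Rightarrow> complex) \<Rightarrow> real \<Rightarrow> bool" where
  "is_rlct \<zeta> l \<longleftrightarrow>
     (\<exists>Z. Z meromorphic_on UNIV \<and> (\<forall>z. Re z > 0 \<longrightarrow> Z z = \<zeta> z) \<and>
          is_pole Z (- complex_of_real l) \<and> (\<forall>p. is_pole Z p \<longrightarrow> Re p \<le> - l))"

end

theory Submission
  imports Defs
begin

text \<open>
  Let \<open>\<mu>\<close> be the prior on \<open>K\<close>-valued factor pairs and \<open>f = \<parallel>U V - W\<parallel>\<^sup>2\<close> with \<open>W = U\<^sub>0 V\<^sub>0\<close>, so that for
  \<open>Re z > 0\<close> the zeta function is \<open>\<integral> f\<^sup>z d\<mu>\<close>.  The largest pole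
  is governed by how fast \<open>vol(r) = \<mu> {0 < f \<le> r}\<close> tends to \<open>0\<close>.

  For the upper bound, write \<open>f = B exp (- t)\<close> with \<open>t \<ge> 0\<close>; up to the factor \<open>B\<^sup>z\<close> the zeta function
  is the Laplace transform of the law of \<open>t\<close>.  By Landau's theorem on Laplace transforms of positive
  measures (\<open>laplace_landau\<close>), a meromorphic continuation whose poles all have real part at most
  \<open>- l\<close> forces \<open>\<integral> f powr (- s) d\<mu> < \<infinity>\<close> for every \<open>s < l\<close>.  Since this integral is at least
  \<open>r powr (- s) * vol(r)\<close>, a bound \<open>vol(r) \<ge> c r\<^sup>L\<close> along radii tending to \<open>0\<close> yields \<open>l \<le> L\<close>
  (\<open>is_rlct_le\<close>).  Conversely, \<open>vol(r) \<le> C r\<^sup>L\<close> makes those integrals finite for all \<open>s < L\<close>, the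
  Laplace transform is then holomorphic on \<open>Re z > - L\<close>, and no pole of the continuation can lie
  there, so \<open>l \<ge> L\<close> (\<open>is_rlct_ge\<close>).

  The volume bounds come from boxes, whose \<open>\<mu>\<close>-measure is a product of one-dimensional gamma measures.
  For the lower bound (\<open>volume_lower_bound\<close>) take a factorization \<open>W = A B\<close> of inner size \<open>H\<^sub>0\<close> with
  entries in the interior of \<open>K\<close>.  It may be rescaled: replacing column \<open>k\<close> of \<open>A\<close> by its multiple with
  factor \<open>t\<^sub>k\<close> and row \<open>k\<close> of \<open>B\<close> by its multiple with factor \<open>1 / t\<^sub>k\<close> does not change the product.
  Around every such pair, all \<open>H\<^sub>0 (M + N)\<close> entries may be moved by order \<open>\<epsilon>\<close>; letting each \<open>t\<^sub>k\<close> run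
  through a grid of mesh \<open>\<epsilon>\<close> gives order \<open>\<epsilon> powr (- H\<^sub>0)\<close> disjoint boxes and hence the exponent
  \<open>H\<^sub>0 (M + N - 1)\<close>.  In the remaining \<open>H - H\<^sub>0\<close> columns of \<open>U\<close> or rows of \<open>V\<close>, whichever is cheaper,
  the entries are taken of order \<open>\<epsilon>\<close>; an entry costs \<open>\<epsilon> powr \<phi>\<close> because the gamma density behaves like
  \<open>x powr (\<phi> - 1)\<close> at \<open>0\<close>, which accounts for the minimum.  On all these boxes \<open>f\<close> is of order at most
  \<open>\<epsilon>\<^sup>2\<close>, whence the factor \<open>1 / 2\<close>.

  If \<open>H = H\<^sub>0 = 1\<close>, then \<open>f \<le> \<epsilon>\<^sup>2\<close> with \<open>\<epsilon>\<close> small keeps all entries away from \<open>0\<close>, where the gamma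
  densities are bounded, and the first entry of \<open>U\<close> determines all other entries up to order \<open>\<epsilon>\<close>.
  So the sublevel set is covered by order \<open>1 / \<epsilon>\<close> boxes of measure of order \<open>\<epsilon> ^ (M + N)\<close>
  (\<open>volume_upper_bound_rank_one\<close>), and the two bounds match.
\<close>

section \<open>Laplace transforms of positive measures\<close>

lemma exp_partial_sum_le:
  fixes x :: real
  assumes "0 \<le> x"
  shows "(\<Sum>i<n. x ^ i / fact i) \<le> exp x"
proof -
  have "(\<Sum>i<n. x ^ i / fact i) \<le> (\<Sum>i. x ^ i / fact i)"
    using summable_exp[of x] assms
    by (intro sum_le_suminf) (auto simp: field_simps)
  then show ?thesis
    by (simp add: exp_def divide_inverse mult.commute scaleR_conv_of_real)
qed

text \<open>
  Expanding \<open>exp (- w t)\<close> under the integral sign: all partial sums of the expansion are dominated by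
  \<open>exp (- (Re c - \<rho>) t)\<close>, so integrability of this one real exponential gives the whole power series
  on the disc of radius \<open>\<rho>\<close> around \<open>c\<close>.
\<close>
lemma laplace_power_series:
  fixes t :: "'a \<Rightarrow> real" and c w :: complex
  assumes meas [measurable]: "t \<in> borel_measurable M"
    and nonneg: "AE x in M. 0 \<le> t x"
    and int: "integrable M (\<lambda>x. exp (- (Re c - \<rho>) * t x))"
    and "0 < \<rho>" and w: "cmod w \<le> \<rho>"
  shows laplace_coeff_integrable:
      "integrable M (\<lambda>x. exp (- c * of_real (t x)) * (- of_real (t x)) ^ n / fact n)"
    and laplace_coeff_sums:
      "(\<lambda>n. (LINT x|M. exp (- c * of_real (t x)) * (- of_real (t x)) ^ n / fact n) * w ^ n)
         sums (LINT x|M. exp (- (c + w) * of_real (t x)))"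
proof -
  let ?a = "\<lambda>n x. exp (- c * of_real (t x)) * (- of_real (t x)) ^ n / fact n :: complex"
  have norm_a: "cmod (?a n x) * r ^ n = exp (- Re c * t x) * ((r * t x) ^ n / fact n)"
    if "0 \<le> t x" for n x r
    using that by (simp add: norm_mult norm_divide norm_power power_mult_distrib)
  have dom: "(\<Sum>i<n. cmod (?a i x) * r ^ i) \<le> exp (- (Re c - \<rho>) * t x)"
    if "0 \<le> t x" "0 \<le> r" "r \<le> \<rho>" for n x r
  proof -
    have "(\<Sum>i<n. cmod (?a i x) * r ^ i) = exp (- Re c * t x) * (\<Sum>i<n. (r * t x) ^ i / fact i)"
      using that(1) by (simp only: norm_a sum_distrib_left)
    also have "\<dots> \<le> exp (- Re c * t x) * exp (r * t x)"
      using that by (intro mult_left_mono exp_partial_sum_le) auto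
    also have "\<dots> \<le> exp (- Re c * t x) * exp (\<rho> * t x)"
      using that by (intro mult_left_mono) (auto intro: mult_right_mono)
    also have "\<dots> = exp (- (Re c - \<rho>) * t x)"
      by (simp add: mult_exp_exp algebra_simps)
    finally show ?thesis .
  qed
  show coeff: "integrable M (?a n)" for n
  proof (rule Bochner_Integration.integrable_bound)
    show "integrable M (\<lambda>x. exp (- (Re c - \<rho>) * t x) / \<rho> ^ n)"
      using int by simp
    show "AE x in M. norm (?a n x) \<le> norm (exp (- (Re c - \<rho>) * t x) / \<rho> ^ n)"
      using nonneg
    proof eventually_elim
      case (elim x)
      have "cmod (?a n x) * \<rho> ^ n \<le> (\<Sum>i<Suc n. cmod (?a i x) * \<rho> ^ i)"
        using \<open>0 < \<rho>\<close> by (intro member_le_sum) auto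
      also have "\<dots> \<le> exp (- (Re c - \<rho>) * t x)"
        using elim \<open>0 < \<rho>\<close> by (intro dom) auto
      finally show ?case
        using \<open>0 < \<rho>\<close> by (simp add: field_simps)
    qed
  qed measurable
  have "(\<lambda>n. LINT x|M. (\<Sum>i<n. ?a i x * w ^ i))
          \<longlonglongrightarrow> (LINT x|M. exp (- (c + w) * of_real (t x)))"
  proof (rule integral_dominated_convergence[where w = "\<lambda>x. exp (- (Re c - \<rho>) * t x)"])
    show "AE x in M. (\<lambda>n. \<Sum>i<n. ?a i x * w ^ i) \<longlonglongrightarrow> exp (- (c + w) * of_real (t x))"
    proof (rule AE_I2)
      fix x
      have "(\<lambda>n. exp (- c * of_real (t x)) * ((- of_real (t x) * w) ^ n /\<^sub>R fact n))
              sums (exp (- c * of_real (t x)) * exp (- of_real (t x) * w))"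
        by (intro sums_mult exp_converges)
      also have "exp (- c * of_real (t x)) * exp (- of_real (t x) * w)
                   = exp (- (c + w) * of_real (t x))"
        by (simp add: mult_exp_exp algebra_simps)
      also have "(\<lambda>n. exp (- c * of_real (t x)) * ((- of_real (t x) * w) ^ n /\<^sub>R fact n))
                   = (\<lambda>n. ?a n x * w ^ n)"
        by (intro ext) (simp only: scaleR_conv_of_real power_mult_distrib of_real_inverse
                                   of_real_fact divide_inverse mult_ac)
      finally show "(\<lambda>n. \<Sum>i<n. ?a i x * w ^ i) \<longlonglongrightarrow> exp (- (c + w) * of_real (t x))"
        by (simp add: sums_def)
    qed
    show "AE x in M. norm (\<Sum>i<n. ?a i x * w ^ i) \<le> exp (- (Re c - \<rho>) * t x)" for n
      using nonneg
    proof eventually_elim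
      case (elim x)
      have "norm (\<Sum>i<n. ?a i x * w ^ i) \<le> (\<Sum>i<n. cmod (?a i x) * cmod w ^ i)"
        by (rule order.trans[OF norm_sum]) (simp add: norm_mult norm_power norm_divide)
      also have "\<dots> \<le> exp (- (Re c - \<rho>) * t x)"
        using elim w by (intro dom) auto
      finally show ?case .
    qed
  qed (use int in auto)
  then show "(\<lambda>n. (LINT x|M. ?a n x) * w ^ n) sums (LINT x|M. exp (- (c + w) * of_real (t x)))"
    unfolding sums_def
    by (subst (asm) Bochner_Integration.integral_sum)
       (intro integrable_mult_left coeff, simp only: integral_mult_left_zero)
qed

lemma laplace_holomorphic:
  fixes t :: "'a \<Rightarrow> real"
  assumes meas [measurable]: "t \<in> borel_measurable M"
    and nonneg: "AE x in M. 0 \<le> t x"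
    and int: "\<And>s. s < L \<Longrightarrow> integrable M (\<lambda>x. exp (s * t x))"
  shows "(\<lambda>z. LINT x|M. exp (- z * complex_of_real (t x))) holomorphic_on {z. - L < Re z}"
    (is "?F holomorphic_on ?S")
proof -
  have "?F field_differentiable at c" if c: "c \<in> ?S" for c
  proof -
    define \<rho> where "\<rho> = (Re c + L) / 2"
    have \<rho>: "0 < \<rho>" and "- (Re c - \<rho>) < L"
      using c by (auto simp: \<rho>_def field_simps)
    then have i: "integrable M (\<lambda>x. exp (- (Re c - \<rho>) * t x))"
      by (intro int)
    have "?F holomorphic_on ball c \<rho>"
    proof (rule power_series_holomorphic)
      fix w assume "w \<in> ball c \<rho>"
      then have "cmod (w - c) \<le> \<rho>"
        by (simp add: dist_norm norm_minus_commute)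
      from laplace_coeff_sums[OF meas nonneg i \<rho> this]
      show "(\<lambda>n. (LINT x|M. exp (- c * of_real (t x)) * (- of_real (t x)) ^ n / fact n)
               * (w - c) ^ n) sums (?F w)"
        by simp
    qed
    then show ?thesis
      using \<rho> by (intro holomorphic_on_imp_differentiable_at[of _ "ball c \<rho>"]) auto
  qed
  then show ?thesis
    by (simp add: holomorphic_on_def field_differentiable_at_within)
qed

text \<open>
  Landau's theorem.  The power series of the transform at \<open>1\<close> converges on the disc of radius \<open>1 + l\<close>,
  because \<open>G\<close> is holomorphic there.  Its coefficients alternate in sign, as \<open>t \<ge> 0\<close>, so at the point
  \<open>- s\<close> every term is nonnegative; summation and integration may therefore be exchanged, and the sum
  of the series is the integral of \<open>exp (- t) * exp ((1 + s) t)\<close>.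
\<close>
lemma laplace_landau:
  fixes t :: "'a \<Rightarrow> real"
  assumes "finite_measure M"
    and meas [measurable]: "t \<in> borel_measurable M"
    and nonneg: "AE x in M. 0 \<le> t x"
    and hol: "G holomorphic_on {z. - l < Re z}"
    and eq: "\<And>z. 0 < Re z \<Longrightarrow> G z = (LINT x|M. exp (- z * complex_of_real (t x)))"
    and s: "0 \<le> s" "s < l"
  shows "integrable M (\<lambda>x. exp (s * t x))"
proof -
  interpret finite_measure M by fact
  let ?a = "\<lambda>n x. exp (- 1 * of_real (t x)) * (- of_real (t x)) ^ n / fact n :: complex"
  define A where "A = Abs_fps (\<lambda>n. LINT x|M. ?a n x)"
  have i: "integrable M (\<lambda>x. exp (- (Re 1 - 1) * t x))"
    by simp
  have "(\<lambda>w. G (1 + w)) has_fps_expansion A"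
  proof (rule has_fps_expansionI)
    have "eventually (\<lambda>w::complex. w \<in> ball 0 1) (nhds 0)"
      by (intro eventually_nhds_in_open) auto
    then show "eventually (\<lambda>w. (\<lambda>n. fps_nth A n * w ^ n) sums G (1 + w)) (nhds 0)"
    proof eventually_elim
      case (elim w)
      have "0 < Re (1 + w)"
        using elim abs_Re_le_cmod[of w] by auto
      then show ?case
        using laplace_coeff_sums[OF meas nonneg i, of w] elim by (simp add: A_def eq)
    qed
  qed
  moreover have "(\<lambda>w. G (1 + w)) holomorphic_on eball 0 (ereal (1 + l))"
  proof -
    have "- l < Re (1 + w)" if "cmod w < 1 + l" for w
      using that abs_Re_le_cmod[of w] by auto
    then have "(\<lambda>w. 1 + w) ` eball 0 (ereal (1 + l)) \<subseteq> {z. - l < Re z}"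
      by (auto simp: eball_def dist_norm)
    then show ?thesis
      by (intro holomorphic_on_compose_gen[OF _ hol, unfolded o_def] holomorphic_intros)
  qed
  ultimately have "ereal (1 + l) \<le> fps_conv_radius A"
    by (rule holomorphic_on_imp_fps_conv_radius_ge)
  moreover have "ereal (norm (of_real (1 + s) :: complex)) < ereal (1 + l)"
    using s by (simp only: norm_of_real) simp
  ultimately have "summable (\<lambda>n. norm (fps_nth A n * of_real (1 + s) ^ n))"
    unfolding fps_conv_radius_def by (intro abs_summable_in_conv_radius) (rule less_le_trans)
  \<comment> \<open>The terms of the series at the point \<open>- s\<close>, that is, at offset \<open>- (1 + s)\<close> from the centre.\<close>
  let ?b = "\<lambda>n x. exp (- t x) * ((1 + s) * t x) ^ n / fact n"
  have a_b: "?a n x * of_real (1 + s) ^ n = (- 1) ^ n * of_real (?b n x)" for n x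
    by (simp add: power_minus[of "of_real (t x)"] power_mult_distrib exp_of_real [symmetric])
  have int_a: "integrable M (?a n)" for n
    using laplace_coeff_integrable[OF meas nonneg i, of 0] by simp
  have int_b: "integrable M (?b n)" for n
  proof -
    have "integrable M (\<lambda>x. (- 1) ^ n * (?a n x * of_real (1 + s) ^ n))"
      by (intro integrable_mult_right integrable_mult_left int_a)
    then have "integrable M (\<lambda>x. complex_of_real (?b n x))"
      unfolding a_b by (simp add: mult.assoc[symmetric] flip: power_mult_distrib)
    then show ?thesis
      unfolding complex_of_real_integrable_eq .
  qed
  have norm_A: "norm (fps_nth A n * of_real (1 + s) ^ n) = (LINT x|M. norm (?b n x))" for n
  proof -
    have "fps_nth A n * of_real (1 + s) ^ n = (LINT x|M. ?a n x * of_real (1 + s) ^ n)"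
      by (simp add: A_def)
    also have "\<dots> = (- 1) ^ n * of_real (LINT x|M. ?b n x)"
      by (simp only: a_b integral_mult_right_zero integral_complex_of_real)
    finally have "norm (fps_nth A n * of_real (1 + s) ^ n) = \<bar>LINT x|M. ?b n x\<bar>"
      by (simp add: norm_mult norm_divide norm_power)
    moreover have ae: "AE x in M. 0 \<le> ?b n x"
      using nonneg by eventually_elim (use s in auto)
    moreover have "AE x in M. norm (?b n x) = ?b n x"
      using ae by eventually_elim (simp only: real_norm_def abs_of_nonneg)
    then have "(LINT x|M. norm (?b n x)) = (LINT x|M. ?b n x)"
      by (intro integral_cong_AE) auto
    moreover have "0 \<le> (LINT x|M. ?b n x)"
      using ae by (rule integral_nonneg_AE)
    ultimately show ?thesis
      by (simp only: abs_of_nonneg)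
  qed
  have sums_b: "(\<lambda>n. ?b n x) sums (exp (- t x) * exp ((1 + s) * t x))" for x
    using sums_mult[OF exp_converges[of "(1 + s) * t x"], of "exp (- t x)"]
    by (simp add: divide_inverse mult_ac scaleR_conv_of_real)
  have "integrable M (\<lambda>x. \<Sum>n. ?b n x)"
  proof (rule integrable_suminf)
    show "AE x in M. summable (\<lambda>n. norm (?b n x))"
      using nonneg
    proof eventually_elim
      case (elim x)
      then have "(\<lambda>n. norm (?b n x)) = (\<lambda>n. ?b n x)"
        using s by (intro ext) (simp add: abs_mult)
      then show ?case
        using sums_b sums_summable by metis
    qed
    show "summable (\<lambda>n. LINT x|M. norm (?b n x))"
      using \<open>summable _\<close> by (simp only: norm_A)
  qed (rule int_b)
  moreover have "(\<Sum>n. ?b n x) = exp (s * t x)" for x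
    using sums_unique[OF sums_b[of x]] by (simp add: mult_exp_exp algebra_simps)
  ultimately show ?thesis
    by simp
qed


section \<open>Zeta functions of the form \<open>\<integral> f\<^sup>z d\<mu>\<close>\<close>
lemma powr_eq_exp_ln_div:
  assumes "0 < y" "0 < B"
  shows "complex_of_real y powr z
           = exp (z * of_real (ln B)) * exp (- z * of_real (ln (B / y)))"
  using assms by (simp add: powr_def Ln_of_real ln_div mult_exp_exp algebra_simps)

lemma exp_ln_div_eq_powr:
  fixes y B s :: real
  assumes "0 < y" "0 < B"
  shows "exp (s * ln (B / y)) = B powr s * y powr (- s)"
  using assms by (simp add: powr_def ln_div mult_exp_exp algebra_simps)

lemma borel_measurable_of_real_powr:
  fixes f :: "'a \<Rightarrow> real"
  assumes [measurable]: "f \<in> borel_measurable M" and "\<And>x. 0 \<le> f x"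
  shows "(\<lambda>x. complex_of_real (f x) powr z) \<in> borel_measurable M"
proof -
  have "(\<lambda>x. complex_of_real (f x) powr z)
          = (\<lambda>x. if f x = 0 then 0 else exp (z * of_real (ln (f x))))"
    using assms(2) by (intro ext) (metis Ln_of_real less_eq_real_def of_real_eq_0_iff powr_def)
  then show ?thesis
    by simp
qed

lemma integral_powr_eq_laplace:
  fixes f :: "'a \<Rightarrow> real"
  assumes [measurable]: "f \<in> borel_measurable M" and nonneg: "\<And>x. 0 \<le> f x"
    and pos: "AE x in M. 0 < f x" and "0 < B"
  shows "(LINT x|M. complex_of_real (f x) powr z)
           = exp (z * of_real (ln B)) * (LINT x|M. exp (- z * of_real (ln (B / f x))))"
proof -
  have "(LINT x|M. complex_of_real (f x) powr z)
          = (LINT x|M. exp (z * of_real (ln B)) * exp (- z * of_real (ln (B / f x))))"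
  proof (rule integral_cong_AE)
    show "AE x in M. complex_of_real (f x) powr z
            = exp (z * of_real (ln B)) * exp (- z * of_real (ln (B / f x)))"
      using pos by eventually_elim (rule powr_eq_exp_ln_div[OF _ \<open>0 < B\<close>])
  qed (use nonneg in \<open>auto intro: borel_measurable_of_real_powr\<close>)
  then show ?thesis
    by simp
qed

lemma integrable_powr_iff_exp:
  fixes f :: "'a \<Rightarrow> real"
  assumes [measurable]: "f \<in> borel_measurable M" and pos: "AE x in M. 0 < f x" and "0 < B"
  shows "integrable M (\<lambda>x. exp (s * ln (B / f x))) \<longleftrightarrow> integrable M (\<lambda>x. f x powr (- s))"
proof -
  have "integrable M (\<lambda>x. exp (s * ln (B / f x))) \<longleftrightarrow> integrable M (\<lambda>x. B powr s * f x powr (- s))"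
  proof (rule integrable_cong_AE)
    show "AE x in M. exp (s * ln (B / f x)) = B powr s * f x powr (- s)"
      using pos by eventually_elim (use \<open>0 < B\<close> in \<open>simp add: exp_ln_div_eq_powr\<close>)
  qed auto
  also have "\<dots> \<longleftrightarrow> integrable M (\<lambda>x. f x powr (- s))"
    using \<open>0 < B\<close> by simp
  finally show ?thesis .
qed

lemma integral_powr_holomorphic:
  fixes f :: "'a \<Rightarrow> real"
  assumes meas [measurable]: "f \<in> borel_measurable M" and nonneg: "\<And>x. 0 \<le> f x"
    and bounds: "AE x in M. 0 < f x \<and> f x \<le> B" and "0 < B"
    and int: "\<And>s. s < L \<Longrightarrow> integrable M (\<lambda>x. f x powr (- s))"
  shows "(\<lambda>z. LINT x|M. complex_of_real (f x) powr z) holomorphic_on {z. - L < Re z}"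
proof -
  have pos: "AE x in M. 0 < f x"
    using bounds by eventually_elim simp
  have "AE x in M. 0 \<le> ln (B / f x)"
    using bounds by eventually_elim (simp add: field_simps)
  then have "(\<lambda>z. LINT x|M. exp (- z * complex_of_real (ln (B / f x)))) holomorphic_on {z. - L < Re z}"
    using int integrable_powr_iff_exp[OF meas pos \<open>0 < B\<close>] by (intro laplace_holomorphic) auto
  then show ?thesis
    unfolding integral_powr_eq_laplace[OF meas nonneg pos \<open>0 < B\<close>]
    by (intro holomorphic_intros)
qed

lemma finite_measure_integrable_powr:
  fixes f :: "'a \<Rightarrow> real"
  assumes "finite_measure M" and meas [measurable]: "f \<in> borel_measurable M"
    and bounds: "AE x in M. 0 < f x \<and> f x \<le> B" and "s \<le> 0"
  shows "integrable M (\<lambda>x. f x powr (- s))"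
proof -
  interpret finite_measure M by fact
  show ?thesis
  proof (rule integrable_const_bound[where B = "B powr (- s)"])
    show "AE x in M. norm (f x powr (- s)) \<le> B powr (- s)"
      using bounds by eventually_elim (use \<open>s \<le> 0\<close> in \<open>auto intro: powr_mono2\<close>)
  qed measurable
qed

text \<open>
  The continuation may take arbitrary values at its removable singularities; only after
  \<open>remove_sings\<close> is it holomorphic to the right of its largest pole, where Landau's theorem is applied.
\<close>
lemma integrable_powr_of_is_rlct:
  fixes f :: "'a \<Rightarrow> real"
  assumes fin: "finite_measure M"
    and meas [measurable]: "f \<in> borel_measurable M" and nonneg: "\<And>x. 0 \<le> f x"
    and bounds: "AE x in M. 0 < f x \<and> f x \<le> B" and "0 < B"
    and \<zeta>: "\<And>z. 0 < Re z \<Longrightarrow> \<zeta> z = (LINT x|M. complex_of_real (f x) powr z)"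
    and rlct: "is_rlct \<zeta> l" and s: "0 \<le> s" "s < l"
  shows "integrable M (\<lambda>x. f x powr (- s))"
proof -
  obtain Z where mero: "Z meromorphic_on UNIV" and Z: "\<And>z. 0 < Re z \<Longrightarrow> Z z = \<zeta> z"
    and pole: "\<And>p. is_pole Z p \<Longrightarrow> Re p \<le> - l"
    using rlct unfolding is_rlct_def by auto
  have pos: "AE x in M. 0 < f x"
    using bounds by eventually_elim simp
  have half_plane: "open {z. (0::real) < Re z}"
    by (rule open_halfspace_Re_gt)
  have "(\<lambda>z. LINT x|M. complex_of_real (f x) powr z) holomorphic_on {z. - 0 < Re z}"
    using fin bounds by (intro integral_powr_holomorphic[OF meas nonneg bounds \<open>0 < B\<close>])
      (auto intro: finite_measure_integrable_powr)
  then have "Z holomorphic_on {z. 0 < Re z}"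
    by (rule holomorphic_cong[THEN iffD1, rotated -1]) (auto simp: Z \<zeta>)
  then have Z_analytic: "Z analytic_on {z}" if "0 < Re z" for z
    using that half_plane by (auto simp: analytic_on_open [symmetric] intro: analytic_on_subset)
  have hol: "remove_sings Z holomorphic_on {z. - l < Re z}"
  proof -
    have "remove_sings Z analytic_on {z}" if "- l < Re z" for z
    proof (rule nicely_meromorphic_on_imp_analytic_at[OF remove_sings_nicely_meromorphic[OF mero]])
      have "\<not> is_pole Z z"
        using pole that by fastforce
      then show "\<not> is_pole (remove_sings Z) z"
        using meromorphic_on_isolated_singularity[OF meromorphic_on_subset[OF mero]]
        by (simp add: is_pole_remove_sings_iff)
    qed simp
    then show ?thesis
      by (intro analytic_imp_holomorphic) (simp add: analytic_on_analytic_at [of _ "Collect _"])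
  qed
  define G where "G z = exp (- z * of_real (ln B)) * remove_sings Z z" for z
  have "integrable M (\<lambda>x. exp (s * ln (B / f x)))"
  proof (rule laplace_landau[OF fin, of _ G])
    show "AE x in M. 0 \<le> ln (B / f x)"
      using bounds by eventually_elim (simp add: field_simps)
    show "G holomorphic_on {z. - l < Re z}"
      unfolding G_def by (intro holomorphic_intros hol)
    fix z :: complex assume z: "0 < Re z"
    then have "remove_sings Z z = (LINT x|M. complex_of_real (f x) powr z)"
      by (simp add: Z_analytic Z \<zeta>)
    then show "G z = (LINT x|M. exp (- z * complex_of_real (ln (B / f x))))"
      unfolding G_def integral_powr_eq_laplace[OF meas nonneg pos \<open>0 < B\<close>]
      by (simp add: mult.assoc[symmetric] mult_exp_exp)
  qed (use s in auto)
  then show ?thesis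
    using integrable_powr_iff_exp[OF meas pos \<open>0 < B\<close>] by simp
qed

text \<open>
  Under the integrability hypothesis \<open>\<integral> f\<^sup>z d\<mu>\<close> is itself holomorphic on \<open>Re z > - L\<close>.  The continuation
  agrees with it near \<open>1\<close>, hence outside a discrete subset of that half-plane, and near a pole it cannot
  agree with a holomorphic function.
\<close>
lemma is_rlct_ge_of_integrable_powr:
  fixes f :: "'a \<Rightarrow> real"
  assumes meas [measurable]: "f \<in> borel_measurable M" and nonneg: "\<And>x. 0 \<le> f x"
    and bounds: "AE x in M. 0 < f x \<and> f x \<le> B" and "0 < B"
    and \<zeta>: "\<And>z. 0 < Re z \<Longrightarrow> \<zeta> z = (LINT x|M. complex_of_real (f x) powr z)"
    and rlct: "is_rlct \<zeta> l" and "0 < L"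
    and int: "\<And>s. s < L \<Longrightarrow> integrable M (\<lambda>x. f x powr (- s))"
  shows "L \<le> l"
proof (rule ccontr)
  assume "\<not> L \<le> l"
  obtain Z where mero: "Z meromorphic_on UNIV" and Z: "\<And>z. 0 < Re z \<Longrightarrow> Z z = \<zeta> z"
    and pole: "is_pole Z (- of_real l)"
    using rlct unfolding is_rlct_def by auto
  define F where "F z = (LINT x|M. complex_of_real (f x) powr z)" for z
  let ?S = "{z. - L < Re z}"
  have S: "open ?S" "connected ?S"
    by (auto simp: open_halfspace_Re_gt intro: convex_connected convex_halfspace_Re_gt)
  have F: "F holomorphic_on ?S"
    unfolding F_def using int by (intro integral_powr_holomorphic[OF meas nonneg bounds \<open>0 < B\<close>])
  then have "(\<lambda>z. Z z - F z) meromorphic_on ?S"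
    using mero S(1) by (intro meromorphic_intros meromorphic_on_subset[OF mero]
        analytic_on_imp_meromorphic_on) (auto simp: analytic_on_open)
  then have "eventually (\<lambda>z. Z z - F z = 0) (cosparse ?S) \<or> eventually (\<lambda>z. Z z - F z \<noteq> 0) (cosparse ?S)"
    using S by (intro meromorphic_imp_constant_or_avoid)
  moreover have "\<not> eventually (\<lambda>z. Z z - F z \<noteq> 0) (cosparse ?S)"
  proof
    assume "eventually (\<lambda>z. Z z - F z \<noteq> 0) (cosparse ?S)"
    then have "eventually (\<lambda>z. Z z - F z \<noteq> 0) (at 1)"
      using S(1) \<open>0 < L\<close> by (simp add: eventually_cosparse_open_eq)
    moreover have "eventually (\<lambda>z. z \<in> {z. 0 < Re z}) (at 1)"
      by (intro eventually_at_in_open') (auto simp: open_halfspace_Re_gt)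
    then have "eventually (\<lambda>z. Z z - F z = 0) (at 1)"
      by eventually_elim (simp add: Z \<zeta> F_def)
    ultimately have "eventually (\<lambda>z. False) (at (1::complex))"
      by eventually_elim simp
    then show False
      by simp
  qed
  ultimately have "eventually (\<lambda>z. Z z - F z = 0) (at (- of_real l))"
    using S(1) \<open>\<not> L \<le> l\<close> by (auto simp: eventually_cosparse_open_eq)
  then have "eventually (\<lambda>z. Z z = F z) (at (- of_real l))"
    by eventually_elim simp
  then have "is_pole F (- of_real l)"
    using pole by (simp cong: is_pole_cong)
  moreover have "F analytic_on {- of_real l}"
    using F S(1) \<open>\<not> L \<le> l\<close> by (auto simp: analytic_on_open [symmetric] intro: analytic_on_subset)
  ultimately show False
    using analytic_at_imp_no_pole by blast
qed


text \<open>
  The level set \<open>f = 0\<close> contributes nothing to \<open>\<integral> f\<^sup>z d\<mu>\<close>, as \<open>0 powr z = 0\<close>, but \<open>ln (B / f)\<close> is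
  meaningless on it.  Removing it from the measure makes the passage to Laplace transforms possible.
\<close>
lemma drop_null_level:
  fixes f :: "'a \<Rightarrow> real"
  assumes "finite_measure M"
    and meas [measurable]: "f \<in> borel_measurable M" and nonneg: "\<And>x. 0 \<le> f x"
    and bounds: "AE x in M. f x \<le> B"
  defines "M' \<equiv> density M (\<lambda>x. ennreal (indicat_real {x. f x \<noteq> 0} x))"
  shows "finite_measure M'" and "AE x in M'. 0 < f x \<and> f x \<le> B"
    and "integrable M' (\<lambda>x. f x powr s) \<longleftrightarrow> integrable M (\<lambda>x. f x powr s)"
    and "(LINT x|M'. complex_of_real (f x) powr z) = (LINT x|M. complex_of_real (f x) powr z)"
proof -
  interpret finite_measure M by fact
  have [measurable]: "(\<lambda>x. indicat_real {x. f x \<noteq> 0} x) \<in> borel_measurable M"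
    unfolding indicator_def by measurable
  show "finite_measure M'"
  proof (rule finite_measureI)
    have "emeasure M' (space M')
            = (\<integral>\<^sup>+x. ennreal (indicat_real {x. f x \<noteq> 0} x) * indicator (space M) x \<partial>M)"
      unfolding M'_def by (subst emeasure_density) auto
    also have "\<dots> \<le> (\<integral>\<^sup>+x. 1 \<partial>M)"
      by (intro nn_integral_mono) (auto split: split_indicator)
    also have "\<dots> < \<infinity>"
      by (simp add: emeasure_eq_measure)
    finally show "emeasure M' (space M') \<noteq> \<infinity>"
      by simp
  qed
  show "AE x in M'. 0 < f x \<and> f x \<le> B"
    unfolding M'_def using bounds nonneg
    by (subst AE_density) (auto simp: indicator_def less_le)
  have "integrable M' (\<lambda>x. f x powr s)
          \<longleftrightarrow> integrable M (\<lambda>x. indicat_real {x. f x \<noteq> 0} x *\<^sub>R f x powr s)"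
    unfolding M'_def by (rule integrable_density) auto
  also have "(\<lambda>x. indicat_real {x. f x \<noteq> 0} x *\<^sub>R f x powr s) = (\<lambda>x. f x powr s)"
    by (auto simp: indicator_def)
  finally show "integrable M' (\<lambda>x. f x powr s) \<longleftrightarrow> integrable M (\<lambda>x. f x powr s)" .
  have "(LINT x|M'. complex_of_real (f x) powr z)
          = (LINT x|M. indicat_real {x. f x \<noteq> 0} x *\<^sub>R (complex_of_real (f x) powr z))"
    unfolding M'_def
    by (rule integral_density) (auto intro: borel_measurable_of_real_powr nonneg)
  also have "(\<lambda>x. indicat_real {x. f x \<noteq> 0} x *\<^sub>R (complex_of_real (f x) powr z))
               = (\<lambda>x. complex_of_real (f x) powr z)"
    by (auto simp: indicator_def)
  finally show "(LINT x|M'. complex_of_real (f x) powr z) = (LINT x|M. complex_of_real (f x) powr z)" .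
qed

text \<open>
  For \<open>L < s < l\<close> the integral of \<open>f powr (- s)\<close> would be finite, yet it is at least
  \<open>c * \<eta> n powr (L - s)\<close>, which is unbounded.
\<close>
lemma is_rlct_le:
  fixes f :: "'a \<Rightarrow> real"
  assumes fin: "finite_measure M"
    and meas [measurable]: "f \<in> borel_measurable M" and nonneg: "\<And>x. 0 \<le> f x"
    and bounds: "AE x in M. f x \<le> B" and "0 < B"
    and \<zeta>: "\<And>z. 0 < Re z \<Longrightarrow> \<zeta> z = (LINT x|M. complex_of_real (f x) powr z)"
    and rlct: "is_rlct \<zeta> l" and "0 \<le> L"
    and \<eta>: "\<And>n. 0 < \<eta> n" "\<eta> \<longlonglongrightarrow> 0" and "0 < c"
    and lower: "\<And>n::nat. c * \<eta> n powr L \<le> measure M {x \<in> space M. 0 < f x \<and> f x \<le> \<eta> n}"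
  shows "l \<le> L"
proof (rule ccontr)
  interpret finite_measure M by fact
  assume "\<not> l \<le> L"
  define s where "s = (L + l) / 2"
  have s: "0 \<le> s" "s < l" "L < s"
    using \<open>\<not> l \<le> L\<close> \<open>0 \<le> L\<close> by (auto simp: s_def)
  note restr = drop_null_level[OF fin meas nonneg bounds]
  have int: "integrable M (\<lambda>x. f x powr (- s))"
    unfolding restr(3) [symmetric]
    by (rule integrable_powr_of_is_rlct[OF restr(1) _ nonneg restr(2) \<open>0 < B\<close> _ rlct s(1,2)])
       (auto simp: \<zeta> restr(4))
  define I where "I = (LINT x|M. f x powr (- s))"
  have "c \<le> I * \<eta> n powr (s - L)" for n
  proof -
    let ?A = "{x \<in> space M. 0 < f x \<and> f x \<le> \<eta> n}"
    have "\<eta> n powr (- s) * measure M ?A = (LINT x|M. indicator ?A x * \<eta> n powr (- s))"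
      by (simp add: mult.commute)
    also have "\<dots> \<le> I"
      unfolding I_def
    proof (rule integral_mono[OF _ int])
      show "integrable M (\<lambda>x. indicator ?A x * \<eta> n powr (- s))"
        by (intro integrable_mult_left integrable_real_indicator) (auto simp: emeasure_eq_measure)
      show "indicator ?A x * \<eta> n powr (- s) \<le> f x powr (- s)" for x
        using \<eta>(1)[of n] s(1) by (auto simp: indicator_def intro: powr_mono2')
    qed
    finally have "\<eta> n powr (- s) * (c * \<eta> n powr L) \<le> I"
      using lower[of n] by (meson mult_left_mono order.trans powr_ge_zero)
    then have "c * \<eta> n powr (L - s) \<le> I"
      by (simp add: powr_diff powr_minus field_simps)
    then have "c * \<eta> n powr (L - s) * \<eta> n powr (s - L) \<le> I * \<eta> n powr (s - L)"
      by (intro mult_right_mono) auto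
    then show ?thesis
      using \<eta>(1)[of n] by (simp add: mult.assoc flip: powr_add)
  qed
  moreover have "(\<lambda>n. I * \<eta> n powr (s - L)) \<longlonglongrightarrow> I * 0"
    using \<eta> s(3) by (intro tendsto_mult_left tendsto_zero_powrI[of _ _ _ "s - L"]) (auto simp: less_imp_le)
  ultimately have "c \<le> I * 0"
    by (intro LIMSEQ_le_const) auto
  then show False
    using \<open>0 < c\<close> by simp
qed

text \<open>
  Dyadic decomposition: the shell \<open>\<eta> / 2 ^ (k + 1) < f \<le> \<eta> / 2 ^ k\<close> contributes at most a constant times
  \<open>2 powr (- k * (L - s))\<close>.
\<close>
lemma integrable_powr_of_volume_upper_bound:
  fixes f :: "'a \<Rightarrow> real"
  assumes fin: "finite_measure M"
    and meas [measurable]: "f \<in> borel_measurable M" and nonneg: "\<And>x. 0 \<le> f x"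
    and "0 < s" "s < L" "0 < \<eta>"
    and upper: "\<And>r. 0 < r \<Longrightarrow> r \<le> \<eta> \<Longrightarrow> measure M {x \<in> space M. 0 < f x \<and> f x \<le> r} \<le> C * r powr L"
  shows "integrable M (\<lambda>x. f x powr (- s))"
proof (rule integrableI_bounded)
  interpret finite_measure M by fact
  define r where "r k = \<eta> / 2 ^ k" for k :: nat
  have r_pos: "0 < r k" and r_le: "r k \<le> \<eta>" and r_Suc: "r (Suc k) = r k / 2" for k
    using \<open>0 < \<eta>\<close> by (auto simp: r_def field_simps)
  let ?A = "\<lambda>k. {x \<in> space M. 0 < f x \<and> f x \<le> r k}"
  have pointwise: "ennreal (f x powr (- s))
      \<le> ennreal (\<eta> powr (- s)) + (\<Sum>k. ennreal (r (Suc k) powr (- s)) * indicator (?A k) x)"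
    if "x \<in> space M" for x
  proof (cases "0 < f x \<and> f x \<le> \<eta>")
    case False
    then have "f x powr (- s) \<le> \<eta> powr (- s)"
      using \<open>0 < \<eta>\<close> \<open>0 < s\<close> nonneg[of x] by (cases "f x = 0") (auto intro: powr_mono2')
    then show ?thesis
      by (intro add_increasing2) (auto intro: ennreal_leI)
  next
    case True
    have "\<exists>k. r (Suc k) < f x"
    proof -
      obtain k where "(1 / 2) ^ k < f x / \<eta>"
        using real_arch_pow_inv[of "f x / \<eta>" "1 / 2"] True \<open>0 < \<eta>\<close> by auto
      then have "r k < f x"
        using \<open>0 < \<eta>\<close> by (simp add: r_def field_simps)
      then show ?thesis
        using r_pos[of k] by (auto simp: r_Suc intro: exI[of _ k])
    qed
    define k where "k = (LEAST k. r (Suc k) < f x)"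
    have k: "r (Suc k) < f x"
      unfolding k_def by (rule LeastI_ex) fact
    have "f x \<le> r k"
    proof (cases k)
      case 0
      then show ?thesis
        using True by (simp add: r_def)
    next
      case (Suc j)
      then have "\<not> r (Suc j) < f x"
        using not_less_Least[of j "\<lambda>k. r (Suc k) < f x"] by (simp add: k_def)
      then show ?thesis
        using Suc by simp
    qed
    define g where "g j = ennreal (r (Suc j) powr (- s)) * indicator (?A j) x" for j
    have "ennreal (f x powr (- s)) \<le> g k"
      unfolding g_def using \<open>f x \<le> r k\<close> True k r_pos[of "Suc k"] \<open>0 < s\<close> that
      by (auto intro!: ennreal_leI powr_mono2')
    also have "\<dots> = (\<Sum>j\<in>{k}. g j)"
      by simp
    also have "\<dots> \<le> (\<Sum>j. g j)"
      by (intro sum_le_suminf) auto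
    finally show ?thesis
      unfolding g_def by (intro add_increasing) auto
  qed
  define q where "q = (1 / 2) powr (L - s)"
  have q: "0 \<le> q" "q < 1"
    using \<open>s < L\<close> powr_less_one[of "1 / 2" "L - s"] by (auto simp: q_def powr01_less_one)
  define D where "D = C * \<eta> powr (L - s) * 2 powr s"
  have dyadic: "r (Suc k) powr (- s) * measure M (?A k) \<le> D * q ^ k" for k
  proof -
    have "r (Suc k) powr (- s) * measure M (?A k) \<le> r (Suc k) powr (- s) * (C * r k powr L)"
      by (intro mult_left_mono upper r_pos r_le) auto
    also have "\<dots> = C * 2 powr s * r k powr (L - s)"
      using r_pos[of k] by (simp add: r_Suc powr_divide powr_diff powr_minus field_simps)
    also have "r k powr (L - s) = \<eta> powr (L - s) * q ^ k"
      using \<open>0 < \<eta>\<close> by (simp add: r_def q_def powr_divide powr_realpow [symmetric] powr_powr mult.commute powr_one)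
    finally show ?thesis
      by (simp add: D_def mult_ac)
  qed
  have D: "0 \<le> D"
    using order.trans[OF _ dyadic[of 0], of 0] by simp
  have "(\<integral>\<^sup>+x. ennreal (norm (f x powr (- s))) \<partial>M)
      \<le> (\<integral>\<^sup>+x. ennreal (\<eta> powr (- s)) + (\<Sum>k. ennreal (r (Suc k) powr (- s)) * indicator (?A k) x) \<partial>M)"
    using pointwise by (intro nn_integral_mono) simp
  also have "\<dots> = ennreal (\<eta> powr (- s)) * emeasure M (space M)
      + (\<Sum>k. ennreal (r (Suc k) powr (- s)) * emeasure M (?A k))"
    by (simp add: nn_integral_add nn_integral_suminf nn_integral_cmult_indicator)
  also have "(\<Sum>k. ennreal (r (Suc k) powr (- s)) * emeasure M (?A k)) \<le> (\<Sum>k. ennreal (D * q ^ k))"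
    using dyadic by (intro suminf_le) (auto simp: emeasure_eq_measure ennreal_mult' [symmetric] intro: ennreal_leI)
  also have "(\<Sum>k. ennreal (D * q ^ k)) = ennreal (\<Sum>k. D * q ^ k)"
    using q D by (intro suminf_ennreal2) (auto intro: summable_mult summable_geometric)
  finally show "(\<integral>\<^sup>+x. ennreal (norm (f x powr (- s))) \<partial>M) < \<infinity>"
    by (rule order.strict_trans1) (auto simp: emeasure_eq_measure ennreal_mult_less_top)
qed measurable

lemma is_rlct_ge:
  fixes f :: "'a \<Rightarrow> real"
  assumes fin: "finite_measure M"
    and meas [measurable]: "f \<in> borel_measurable M" and nonneg: "\<And>x. 0 \<le> f x"
    and bounds: "AE x in M. f x \<le> B" and "0 < B"
    and \<zeta>: "\<And>z. 0 < Re z \<Longrightarrow> \<zeta> z = (LINT x|M. complex_of_real (f x) powr z)"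
    and rlct: "is_rlct \<zeta> l" and "0 < L" "0 < \<eta>"
    and upper: "\<And>r. 0 < r \<Longrightarrow> r \<le> \<eta> \<Longrightarrow> measure M {x \<in> space M. 0 < f x \<and> f x \<le> r} \<le> C * r powr L"
  shows "L \<le> l"
proof -
  note restr = drop_null_level[OF fin meas nonneg bounds]
  have int: "integrable (density M (\<lambda>x. ennreal (indicat_real {x. f x \<noteq> 0} x))) (\<lambda>x. f x powr (- s))"
    if "s < L" for s
  proof (cases "s \<le> 0")
    case True
    then show ?thesis
      using finite_measure_integrable_powr[OF restr(1) _ restr(2)] by simp
  next
    case False
    then show ?thesis
      unfolding restr(3)
      using integrable_powr_of_volume_upper_bound[OF fin meas nonneg _ that \<open>0 < \<eta>\<close> upper] by simp
  qed
  show ?thesis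
    by (rule is_rlct_ge_of_integrable_powr[OF _ nonneg restr(2) \<open>0 < B\<close> _ rlct \<open>0 < L\<close> int])
       (auto simp: \<zeta> restr(4))
qed


section \<open>Gamma measures on the line\<close>
definition gamma_density :: "real \<Rightarrow> real \<Rightarrow> real \<Rightarrow> real" where
  "gamma_density \<phi> \<theta> x = \<theta> powr \<phi> / Gamma \<phi> * x powr (\<phi> - 1) * exp (- \<theta> * x)"

definition gamma_measure :: "real \<Rightarrow> real \<Rightarrow> real set \<Rightarrow> real measure" where
  "gamma_measure \<phi> \<theta> K = density lborel (\<lambda>x. ennreal (indicator K x * gamma_density \<phi> \<theta> x))"

text \<open>
  A matrix is represented by the family of its entries, so that the measure is literally a product
  measure; \<open>Matrix.mat\<close> carries it to matrices.
\<close>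
definition gamma_matrix_measure :: "nat \<Rightarrow> nat \<Rightarrow> real \<Rightarrow> real \<Rightarrow> real set \<Rightarrow> (nat \<times> nat \<Rightarrow> real) measure" where
  "gamma_matrix_measure m n \<phi> \<theta> K = Pi\<^sub>M ({..<m} \<times> {..<n}) (\<lambda>_. gamma_measure \<phi> \<theta> K)"

lemma gamma_density_measurable [measurable]: "gamma_density \<phi> \<theta> \<in> borel_measurable borel"
  unfolding gamma_density_def by measurable

lemma gamma_density_nonneg: "0 < \<phi> \<Longrightarrow> 0 \<le> gamma_density \<phi> \<theta> x"
  by (simp add: gamma_density_def Gamma_real_pos less_imp_le)

lemma sets_gamma_measure [simp, measurable_cong]: "sets (gamma_measure \<phi> \<theta> K) = sets borel"
  and space_gamma_measure [simp]: "space (gamma_measure \<phi> \<theta> K) = UNIV"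
  by (simp_all add: gamma_measure_def)

lemma finite_gamma_measure:
  assumes "compact K" "K \<subseteq> {0..}" "0 < \<phi>" "0 < \<theta>"
  shows "finite_measure (gamma_measure \<phi> \<theta> K)"
proof (rule finite_measureI)
  have [measurable]: "K \<in> sets borel"
    using assms(1) by (simp add: borel_compact)
  obtain R where R: "\<And>x. x \<in> K \<Longrightarrow> norm x \<le> R"
    using compact_imp_bounded[OF assms(1)] by (auto simp: bounded_iff)
  define S where "S = max R 0"
  have K_le: "K \<subseteq> {0..S}"
    using R assms(2) by (force simp: S_def)
  define c where "c = \<theta> powr \<phi> / Gamma \<phi>"
  have "0 \<le> c"
    using assms(3) by (simp add: c_def Gamma_real_pos less_imp_le)
  have "((\<lambda>x. c * x powr (\<phi> - 1)) has_integral (c * (S powr (\<phi> - 1 + 1) / (\<phi> - 1 + 1)))) {0..S}"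
    using assms(3) by (intro has_integral_mult_right has_integral_powr_from_0) (auto simp: S_def)
  then have int: "(\<integral>\<^sup>+x. ennreal (indicator {0..S} x * (c * x powr (\<phi> - 1))) \<partial>lborel)
               = ennreal (c * (S powr (\<phi> - 1 + 1) / (\<phi> - 1 + 1)))"
    using \<open>0 \<le> c\<close> by (intro nn_integral_has_integral_lebesgue) auto
  have "emeasure (gamma_measure \<phi> \<theta> K) (space (gamma_measure \<phi> \<theta> K))
          = (\<integral>\<^sup>+x. ennreal (indicator K x * gamma_density \<phi> \<theta> x) \<partial>lborel)"
    unfolding gamma_measure_def by (subst emeasure_density) auto
  also have "\<dots> \<le> (\<integral>\<^sup>+x. ennreal (indicator {0..S} x * (c * x powr (\<phi> - 1))) \<partial>lborel)"
  proof (intro nn_integral_mono ennreal_leI)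
    fix x
    show "indicator K x * gamma_density \<phi> \<theta> x \<le> indicator {0..S} x * (c * x powr (\<phi> - 1))"
    proof (cases "x \<in> K")
      case True
      then have "0 \<le> x" "x \<le> S"
        using K_le by auto
      have "gamma_density \<phi> \<theta> x = c * x powr (\<phi> - 1) * exp (- \<theta> * x)"
        by (simp add: gamma_density_def c_def)
      also have "\<dots> \<le> c * x powr (\<phi> - 1) * 1"
        using \<open>0 \<le> x\<close> \<open>0 \<le> c\<close> \<open>0 < \<theta>\<close> by (intro mult_left_mono) auto
      finally show ?thesis
        using True \<open>0 \<le> x\<close> \<open>x \<le> S\<close> by simp
    qed (use \<open>0 \<le> c\<close> in auto)
  qed
  also have "\<dots> < \<infinity>"
    unfolding int by simp
  finally show "emeasure (gamma_measure \<phi> \<theta> K) (space (gamma_measure \<phi> \<theta> K)) \<noteq> \<infinity>"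
    by simp
qed

lemma gamma_measure_ge:
  assumes "finite_measure (gamma_measure \<phi> \<theta> K)" and [measurable]: "K \<in> sets borel"
    and "x \<le> y" "{x<..y} \<subseteq> K" "0 \<le> c"
    and c: "\<And>w. x < w \<Longrightarrow> w \<le> y \<Longrightarrow> c \<le> gamma_density \<phi> \<theta> w"
  shows "c * (y - x) \<le> measure (gamma_measure \<phi> \<theta> K) {x<..y}"
proof -
  interpret finite_measure "gamma_measure \<phi> \<theta> K" by fact
  have "ennreal (c * (y - x)) = (\<integral>\<^sup>+w. ennreal c * indicator {x<..y} w \<partial>lborel)"
    using assms by (simp add: nn_integral_cmult_indicator ennreal_mult)
  also have "\<dots> \<le> (\<integral>\<^sup>+w. ennreal (indicator K w * gamma_density \<phi> \<theta> w) * indicator {x<..y} w \<partial>lborel)"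
    using assms(4) by (intro nn_integral_mono) (auto split: split_indicator intro!: ennreal_leI c)
  also have "\<dots> = emeasure (gamma_measure \<phi> \<theta> K) {x<..y}"
    unfolding gamma_measure_def by (subst emeasure_density) auto
  finally show ?thesis
    by (simp add: emeasure_eq_measure)
qed

lemma gamma_measure_le:
  assumes "finite_measure (gamma_measure \<phi> \<theta> K)" and [measurable]: "K \<in> sets borel"
    and "A \<in> sets borel" "A \<subseteq> {x..y}" "x \<le> y" "0 \<le> c"
    and c: "\<And>w. w \<in> K \<inter> A \<Longrightarrow> gamma_density \<phi> \<theta> w \<le> c"
  shows "measure (gamma_measure \<phi> \<theta> K) A \<le> c * (y - x)"
proof -
  interpret finite_measure "gamma_measure \<phi> \<theta> K" by fact
  have "emeasure (gamma_measure \<phi> \<theta> K) A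
          = (\<integral>\<^sup>+w. ennreal (indicator K w * gamma_density \<phi> \<theta> w) * indicator A w \<partial>lborel)"
    unfolding gamma_measure_def using assms(3) by (subst emeasure_density) auto
  also have "\<dots> \<le> (\<integral>\<^sup>+w. ennreal c * indicator {x..y} w \<partial>lborel)"
    using assms(4,6) by (intro nn_integral_mono) (auto split: split_indicator intro!: ennreal_leI c)
  also have "\<dots> = ennreal (c * (y - x))"
    using assms by (simp add: nn_integral_cmult_indicator ennreal_mult)
  finally show ?thesis
    using assms(5,6) by (simp add: emeasure_eq_measure)
qed

text \<open>
  Away from \<open>0\<close> the density is comparable to a positive constant, so that the gamma measure of an
  interval is comparable to its length.
\<close>
lemma gamma_density_bounds:
  assumes "0 < \<phi>" "0 < \<theta>" "0 < a" "a \<le> b"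
  obtains c C where "0 < c" "\<And>x. a \<le> x \<Longrightarrow> x \<le> b \<Longrightarrow> c \<le> gamma_density \<phi> \<theta> x"
    "0 < C" "\<And>x. a \<le> x \<Longrightarrow> x \<le> b \<Longrightarrow> gamma_density \<phi> \<theta> x \<le> C"
proof -
  have "continuous_on {a..b} (gamma_density \<phi> \<theta>)"
    unfolding gamma_density_def using assms by (intro continuous_intros) auto
  moreover have "compact {a..b}" "{a..b} \<noteq> {}"
    using assms by auto
  ultimately obtain x0 x1 where x: "x0 \<in> {a..b}" "x1 \<in> {a..b}"
      "\<forall>x\<in>{a..b}. gamma_density \<phi> \<theta> x0 \<le> gamma_density \<phi> \<theta> x"
      "\<forall>x\<in>{a..b}. gamma_density \<phi> \<theta> x \<le> gamma_density \<phi> \<theta> x1"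
    using continuous_attains_inf[of "{a..b}" "gamma_density \<phi> \<theta>"]
      continuous_attains_sup[of "{a..b}" "gamma_density \<phi> \<theta>"] by blast
  have "0 < gamma_density \<phi> \<theta> x0" "0 < gamma_density \<phi> \<theta> x1"
    using x(1,2) assms by (auto simp: gamma_density_def Gamma_real_pos)
  then show thesis
    using x(3,4) by (intro that[of "gamma_density \<phi> \<theta> x0" "gamma_density \<phi> \<theta> x1"]) auto
qed

text \<open>
  The upper half \<open>{x / 2<..x}\<close> of the interval suffices for the order \<open>x powr \<phi>\<close>: on it the density is
  at least a constant times \<open>x powr (\<phi> - 1)\<close>, for \<open>\<phi> < 1\<close> as well as for \<open>\<phi> \<ge> 1\<close>.
\<close>
lemma gamma_measure_near_zero:
  assumes "finite_measure (gamma_measure \<phi> \<theta> K)" "K \<in> sets borel"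
    and "0 < \<phi>" "0 < \<theta>"
  obtains c where "0 < c"
    "\<And>x. 0 < x \<Longrightarrow> x \<le> 1 \<Longrightarrow> {0..x} \<subseteq> K \<Longrightarrow> c * x powr \<phi> \<le> measure (gamma_measure \<phi> \<theta> K) {x / 2<..x}"
proof -
  obtain p where p: "0 < p" "\<And>w. 1 / 2 \<le> w \<Longrightarrow> w \<le> 1 \<Longrightarrow> p \<le> w powr (\<phi> - 1)"
  proof
    show "0 < min 1 ((1 / 2) powr (\<phi> - 1))"
      by simp
    fix w :: real assume w: "1 / 2 \<le> w" "w \<le> 1"
    show "min 1 ((1 / 2) powr (\<phi> - 1)) \<le> w powr (\<phi> - 1)"
    proof (cases "1 \<le> \<phi>")
      case True
      then have "(1 / 2) powr (\<phi> - 1) \<le> w powr (\<phi> - 1)"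
        using w by (intro powr_mono2) auto
      then show ?thesis
        by simp
    next
      case False
      then have "1 powr (\<phi> - 1) \<le> w powr (\<phi> - 1)"
        using w by (intro powr_mono2') auto
      then show ?thesis
        by simp
    qed
  qed
  define c where "c = \<theta> powr \<phi> / Gamma \<phi> * p * exp (- \<theta>)"
  have "0 < c"
    using assms p by (simp add: c_def Gamma_real_pos)
  show thesis
  proof (rule that[of "c / 2"])
    fix x :: real assume x: "0 < x" "x \<le> 1" "{0..x} \<subseteq> K"
    have "c * x powr (\<phi> - 1) * (x - x / 2) \<le> measure (gamma_measure \<phi> \<theta> K) {x / 2<..x}"
    proof (rule gamma_measure_ge[OF assms(1,2)])
      fix w assume w: "x / 2 < w" "w \<le> x"
      have "p * x powr (\<phi> - 1) \<le> (w / x) powr (\<phi> - 1) * x powr (\<phi> - 1)"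
        using w x by (intro mult_right_mono p) (auto simp: field_simps)
      also have "\<dots> = w powr (\<phi> - 1)"
        using w x by (simp add: powr_divide)
      finally have "p * x powr (\<phi> - 1) * exp (- \<theta>) \<le> w powr (\<phi> - 1) * exp (- \<theta> * w)"
        using w x assms(4) p(1) by (intro mult_mono) (auto simp: mult_le_cancel_left1)
      then have "\<theta> powr \<phi> / Gamma \<phi> * (p * x powr (\<phi> - 1) * exp (- \<theta>)) \<le> \<theta> powr \<phi> / Gamma \<phi> * (w powr (\<phi> - 1) * exp (- \<theta> * w))"
        using assms(3) by (intro mult_left_mono) (auto simp: Gamma_real_pos less_imp_le)
      then show "c * x powr (\<phi> - 1) \<le> gamma_density \<phi> \<theta> w"
        by (simp only: c_def gamma_density_def mult_ac)
    qed (use x \<open>0 < c\<close> in auto)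
    also have "c * x powr (\<phi> - 1) * (x - x / 2) = c / 2 * x powr \<phi>"
      using x by (simp add: powr_diff)
    finally show "c / 2 * x powr \<phi> \<le> measure (gamma_measure \<phi> \<theta> K) {x / 2<..x}" .
  qed (use \<open>0 < c\<close> in simp)
qed

section \<open>The zeta function as an integral over entries\<close>
lemma PiM_density:
  assumes "finite I" and "sigma_finite_measure N" and h [measurable]: "h \<in> borel_measurable N"
    and "sigma_finite_measure (density N h)"
  shows "Pi\<^sub>M I (\<lambda>_. density N h) = density (Pi\<^sub>M I (\<lambda>_. N)) (\<lambda>x. \<Prod>i\<in>I. h (x i))"
proof -
  interpret N: product_sigma_finite "\<lambda>_. N"
    using assms(2) by (simp add: product_sigma_finite_def)
  interpret D: product_sigma_finite "\<lambda>_. density N h"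
    using assms(4) by (simp add: product_sigma_finite_def)
  have [measurable]: "(\<lambda>x. \<Prod>i\<in>I. h (x i)) \<in> borel_measurable (Pi\<^sub>M I (\<lambda>_. N))"
    by (intro borel_measurable_prod_ennreal) measurable
  show ?thesis
  proof (rule D.PiM_eqI[symmetric, OF assms(1)])
    show "sets (density (Pi\<^sub>M I (\<lambda>_. N)) (\<lambda>x. \<Prod>i\<in>I. h (x i))) = sets (Pi\<^sub>M I (\<lambda>_. density N h))"
      by (simp cong: sets_PiM_cong)
    fix A assume A: "\<And>i. i \<in> I \<Longrightarrow> A i \<in> sets (density N h)"
    have "emeasure (density (Pi\<^sub>M I (\<lambda>_. N)) (\<lambda>x. \<Prod>i\<in>I. h (x i))) (Pi\<^sub>E I A)
            = (\<integral>\<^sup>+x. (\<Prod>i\<in>I. h (x i)) * indicator (Pi\<^sub>E I A) x \<partial>Pi\<^sub>M I (\<lambda>_. N))"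
      using A assms(1) by (intro emeasure_density) auto
    also have "\<dots> = (\<integral>\<^sup>+x. (\<Prod>i\<in>I. h (x i) * indicator (A i) (x i)) \<partial>Pi\<^sub>M I (\<lambda>_. N))"
    proof (rule nn_integral_cong)
      fix x assume "x \<in> space (Pi\<^sub>M I (\<lambda>_. N))"
      then have "indicator (Pi\<^sub>E I A) x = (\<Prod>i\<in>I. indicator (A i) (x i) :: ennreal)"
        using assms(1) by (auto simp: indicator_def space_PiM PiE_iff prod_zero_iff)
      then show "(\<Prod>i\<in>I. h (x i)) * indicator (Pi\<^sub>E I A) x = (\<Prod>i\<in>I. h (x i) * indicator (A i) (x i))"
        by (simp add: prod.distrib)
    qed
    also have "\<dots> = (\<Prod>i\<in>I. \<integral>\<^sup>+x. h x * indicator (A i) x \<partial>N)"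
      using A by (intro N.product_nn_integral_prod assms(1)) auto
    also have "\<dots> = (\<Prod>i\<in>I. emeasure (density N h) (A i))"
      using A by (intro prod.cong refl) (simp add: emeasure_density)
    finally show "emeasure (density (Pi\<^sub>M I (\<lambda>_. N)) (\<lambda>x. \<Prod>i\<in>I. h (x i))) (Pi\<^sub>E I A)
        = (\<Prod>i\<in>I. emeasure (density N h) (A i))" .
  qed
qed

text \<open>
  The function \<open>g\<close> is measurable exactly if \<open>g \<circ> f\<close> is; otherwise both integrals take the default
  value \<open>0\<close>.
\<close>
lemma integral_embed_measure:
  fixes g :: "'b \<Rightarrow> 'c :: {banach, second_countable_topology}"
  assumes "inj_on f (space M)"
  shows "integral\<^sup>L (embed_measure M f) g = (LINT x|M. g (f x))"
proof (cases "g \<in> borel_measurable (embed_measure M f)")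
  case True
  have "f \<in> measurable M (embed_measure M f)"
    using assms by (rule measurable_embed_measure2')
  then have "integral\<^sup>L (distr M (embed_measure M f) f) g = (LINT x|M. g (f x))"
    using True by (rule integral_distr)
  then show ?thesis
    using embed_measure_eq_distr'[OF assms] by simp
next
  case False
  have "(\<lambda>x. g (f x)) \<notin> borel_measurable M"
  proof
    assume "(\<lambda>x. g (f x)) \<in> borel_measurable M"
    then have "g \<in> borel_measurable (embed_measure M f)"
      by (rule measurable_embed_measure1[where f = f and g = g])
    with False show False
      by contradiction
  qed
  then have "\<not> integrable M (\<lambda>x. g (f x))" "\<not> integrable (embed_measure M f) g"
    using False borel_measurable_integrable[of M "\<lambda>x. g (f x)"]
      borel_measurable_integrable[of "embed_measure M f" g] by auto
  then show ?thesis
    by (simp add: not_integrable_integral_eq)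
qed


definition nmf_loss :: "nat \<Rightarrow> nat \<Rightarrow> nat \<Rightarrow> real mat \<Rightarrow> (nat \<times> nat \<Rightarrow> real) \<times> (nat \<times> nat \<Rightarrow> real) \<Rightarrow> real" where
  "nmf_loss M N H W = (\<lambda>(u, v). \<Sum>i<M. \<Sum>j<N. ((\<Sum>k<H. u (i, k) * v (k, j)) - W $$ (i, j))\<^sup>2)"

lemma nmf_loss_nonneg: "0 \<le> nmf_loss M N H W p"
  by (auto simp: nmf_loss_def case_prod_unfold intro!: sum_nonneg)

lemma frobenius_norm_eq_nmf_loss:
  assumes "W \<in> carrier_mat M N"
  shows "(frobenius_norm (Matrix.mat M H u * Matrix.mat H N v - W))\<^sup>2 = nmf_loss M N H W (u, v)"
proof -
  have entry: "(Matrix.mat M H u * Matrix.mat H N v - W) $$ (i, j)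
          = (\<Sum>k<H. u (i, k) * v (k, j)) - W $$ (i, j)" if "i < M" "j < N" for i j
    using assms that by (simp add: scalar_prod_def lessThan_atLeast0)
  have "(frobenius_norm (Matrix.mat M H u * Matrix.mat H N v - W))\<^sup>2
          = (\<Sum>i<M. \<Sum>j<N. ((Matrix.mat M H u * Matrix.mat H N v - W) $$ (i, j))\<^sup>2)"
    using assms unfolding frobenius_norm_def by (subst real_sqrt_pow2) (auto intro!: sum_nonneg)
  then show ?thesis
    unfolding nmf_loss_def using entry by simp
qed

lemma inj_on_mat: "inj_on (Matrix.mat m n) (space (Pi\<^sub>M ({..<m} \<times> {..<n}) (\<lambda>_. N)))"
proof (rule inj_onI)
  fix u v assume uv: "u \<in> space (Pi\<^sub>M ({..<m} \<times> {..<n}) (\<lambda>_. N))"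
      "v \<in> space (Pi\<^sub>M ({..<m} \<times> {..<n}) (\<lambda>_. N))" "Matrix.mat m n u = Matrix.mat m n v"
  show "u = v"
  proof (rule PiE_ext)
    fix p assume "p \<in> {..<m} \<times> {..<n}"
    then obtain i j where p: "p = (i, j)" "i < m" "j < n"
      by auto
    have "Matrix.mat m n u $$ (i, j) = Matrix.mat m n v $$ (i, j)"
      by (simp only: uv(3))
    then show "u p = v p"
      using p by simp
  qed (use uv in \<open>auto simp: space_PiM\<close>)
qed

text \<open>
  The restriction to \<open>K\<close>-valued matrices and the prior factor together over the entries, which makes the
  prior a product of one-dimensional measures.
\<close>
lemma indicator_mats_Gam:
  "indicator (mats m n K) (Matrix.mat m n u) * Gam (Matrix.mat m n u) \<phi> \<theta>
     = (\<Prod>p\<in>{..<m} \<times> {..<n}. indicator K (u p) * gamma_density \<phi> \<theta> (u p))"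
proof -
  have "elements_mat (Matrix.mat m n u) = u ` ({..<m} \<times> {..<n})"
    by (auto simp: elements_mat_def)
  then have mem: "Matrix.mat m n u \<in> mats m n K \<longleftrightarrow> (\<forall>p\<in>{..<m} \<times> {..<n}. u p \<in> K)"
    by (auto simp: mats_def)
  have "indicator (mats m n K) (Matrix.mat m n u) = (\<Prod>p\<in>{..<m} \<times> {..<n}. indicator K (u p) :: real)"
  proof (cases "\<forall>p\<in>{..<m} \<times> {..<n}. u p \<in> K")
    case True
    then have all_one: "(\<Prod>p\<in>{..<m} \<times> {..<n}. indicator K (u p) :: real) = 1"
      by (intro prod.neutral ballI) (simp only: indicator_simps)
    show ?thesis
      unfolding all_one using True mem by simp
  next
    case False
    then obtain p where "p \<in> {..<m} \<times> {..<n}" "u p \<notin> K"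
      by blast
    then have zero: "(\<Prod>p\<in>{..<m} \<times> {..<n}. indicator K (u p) :: real) = 0"
      by (intro prod_zero bexI[of _ p]) auto
    show ?thesis
      unfolding zero using False mem by simp
  qed
  moreover have "Gam (Matrix.mat m n u) \<phi> \<theta> = (\<Prod>p\<in>{..<m} \<times> {..<n}. gamma_density \<phi> \<theta> (u p))"
    by (simp add: Gam_def gamma_density_def prod.cartesian_product case_prod_unfold)
  ultimately show ?thesis
    by (simp add: prod.distrib)
qed

lemma sets_gamma_matrix_measure:
    "sets (gamma_matrix_measure m n \<phi> \<theta> K) = sets (Pi\<^sub>M ({..<m} \<times> {..<n}) (\<lambda>_. borel))"
  and space_gamma_matrix_measure:
    "space (gamma_matrix_measure m n \<phi> \<theta> K) = ({..<m} \<times> {..<n}) \<rightarrow>\<^sub>E UNIV"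
  by (auto simp: gamma_matrix_measure_def space_PiM intro!: sets_PiM_cong)

lemma nmf_loss_measurable:
  assumes "sets P = sets (Pi\<^sub>M ({..<M} \<times> {..<H}) (\<lambda>_. borel))"
    and "sets Q = sets (Pi\<^sub>M ({..<H} \<times> {..<N}) (\<lambda>_. borel))"
  shows "nmf_loss M N H W \<in> borel_measurable (P \<Otimes>\<^sub>M Q)"
proof -
  have [measurable]: "(\<lambda>p. fst p (i, k)) \<in> borel_measurable (P \<Otimes>\<^sub>M Q)" if "i < M" "k < H" for i k
  proof (rule measurable_compose[OF measurable_fst])
    show "(\<lambda>u. u (i, k)) \<in> borel_measurable P"
      using that by (subst measurable_cong_sets[OF assms(1) refl], intro measurable_component_singleton) simp
  qed
  have [measurable]: "(\<lambda>p. snd p (k, j)) \<in> borel_measurable (P \<Otimes>\<^sub>M Q)" if "k < H" "j < N" for j k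
  proof (rule measurable_compose[OF measurable_snd])
    show "(\<lambda>v. v (k, j)) \<in> borel_measurable Q"
      using that by (subst measurable_cong_sets[OF assms(2) refl], intro measurable_component_singleton) simp
  qed
  show ?thesis
    unfolding nmf_loss_def case_prod_unfold
    by (intro borel_measurable_sum borel_measurable_power borel_measurable_diff
        borel_measurable_times borel_measurable_const) auto
qed

lemma gamma_matrix_measure_eq_density:
  assumes "compact K" "K \<subseteq> {0..}" "0 < \<phi>" "0 < \<theta>"
  shows "gamma_matrix_measure m n \<phi> \<theta> K = density (Pi\<^sub>M ({..<m} \<times> {..<n}) (\<lambda>_. lborel))
     (\<lambda>u. ennreal (indicator (mats m n K) (Matrix.mat m n u) * Gam (Matrix.mat m n u) \<phi> \<theta>))"
proof -
  have [measurable]: "K \<in> sets borel"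
    using assms(1) by (simp add: borel_compact)
  have "sigma_finite_measure (density lborel (\<lambda>x. ennreal (indicator K x * gamma_density \<phi> \<theta> x)))"
    using finite_gamma_measure[OF assms] unfolding gamma_measure_def
    by (simp add: finite_measure_def)
  then have "gamma_matrix_measure m n \<phi> \<theta> K = density (Pi\<^sub>M ({..<m} \<times> {..<n}) (\<lambda>_. lborel))
     (\<lambda>u. \<Prod>p\<in>{..<m} \<times> {..<n}. ennreal (indicator K (u p) * gamma_density \<phi> \<theta> (u p)))"
    unfolding gamma_matrix_measure_def gamma_measure_def
    by (intro PiM_density) (auto simp: lborel.sigma_finite_measure_axioms)
  also have "(\<lambda>u. \<Prod>p\<in>{..<m} \<times> {..<n}. ennreal (indicator K (u p) * gamma_density \<phi> \<theta> (u p)))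
      = (\<lambda>u. ennreal (indicator (mats m n K) (Matrix.mat m n u) * Gam (Matrix.mat m n u) \<phi> \<theta>))"
    unfolding indicator_mats_Gam using gamma_density_nonneg[OF assms(3)]
    by (intro ext prod_ennreal) auto
  finally show ?thesis .
qed

lemma indicator_mats_Gam_measurable:
  assumes [measurable]: "K \<in> sets borel"
  shows "(\<lambda>u. indicator (mats m n K) (Matrix.mat m n u) * Gam (Matrix.mat m n u) \<phi> \<theta>)
     \<in> borel_measurable (Pi\<^sub>M ({..<m} \<times> {..<n}) (\<lambda>_. lborel))"
  unfolding indicator_mats_Gam by measurable

lemma integral_mats_Gam:
  fixes F :: "real mat \<Rightarrow> complex"
  assumes "compact K" "K \<subseteq> {0..}" "0 < \<phi>" "0 < \<theta>"
    and F: "(\<lambda>u. F (Matrix.mat m n u)) \<in> borel_measurable (Pi\<^sub>M ({..<m} \<times> {..<n}) (\<lambda>_. borel))"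
  shows "(LINT U:mats m n K|lborel_mat m n. F U * complex_of_real (Gam U \<phi> \<theta>))
           = (LINT u|gamma_matrix_measure m n \<phi> \<theta> K. F (Matrix.mat m n u))"
proof -
  let ?P = "Pi\<^sub>M ({..<m} \<times> {..<n}) (\<lambda>_. lborel) :: (nat \<times> nat \<Rightarrow> real) measure"
  let ?h = "\<lambda>u. indicator (mats m n K) (Matrix.mat m n u) * Gam (Matrix.mat m n u) \<phi> \<theta>"
  have K: "K \<in> sets borel"
    using assms(1) by (simp add: borel_compact)
  have h_nonneg: "0 \<le> ?h u" for u
    unfolding indicator_mats_Gam using gamma_density_nonneg[OF assms(3)] by (intro prod_nonneg) auto
  have F': "(\<lambda>u. F (Matrix.mat m n u)) \<in> borel_measurable ?P"
    using F by (simp cong: measurable_cong_sets sets_PiM_cong)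
  have "(LINT U:mats m n K|lborel_mat m n. F U * complex_of_real (Gam U \<phi> \<theta>))
          = (LINT u|?P. ?h u *\<^sub>R F (Matrix.mat m n u))"
    unfolding set_lebesgue_integral_def lborel_mat_def integral_embed_measure[OF inj_on_mat]
    by (simp add: scaleR_conv_of_real mult_ac)
  also have "\<dots> = (LINT u|density ?P (\<lambda>u. ennreal (?h u)). F (Matrix.mat m n u))"
    using F' indicator_mats_Gam_measurable[OF K] h_nonneg
    by (intro integral_density[symmetric]) auto
  finally show ?thesis
    unfolding gamma_matrix_measure_eq_density[OF assms(1-4)] .
qed

lemma finite_gamma_matrix_measure:
  assumes "compact K" "K \<subseteq> {0..}" "0 < \<phi>" "0 < \<theta>"
  shows "finite_measure (gamma_matrix_measure m n \<phi> \<theta> K)"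
proof (rule finite_measureI)
  interpret F: finite_measure "gamma_measure \<phi> \<theta> K"
    using assms by (rule finite_gamma_measure)
  interpret product_sigma_finite "\<lambda>_. gamma_measure \<phi> \<theta> K"
    by standard
  have "emeasure (gamma_matrix_measure m n \<phi> \<theta> K) (\<Pi>\<^sub>E p\<in>{..<m} \<times> {..<n}. UNIV)
          = (\<Prod>p\<in>{..<m} \<times> {..<n}. emeasure (gamma_measure \<phi> \<theta> K) UNIV)"
    unfolding gamma_matrix_measure_def by (rule emeasure_PiM) auto
  also have "\<dots> < \<infinity>"
    by (simp add: F.emeasure_eq_measure ennreal_power)
  finally show "emeasure (gamma_matrix_measure m n \<phi> \<theta> K) (space (gamma_matrix_measure m n \<phi> \<theta> K)) \<noteq> \<infinity>"
    by (simp add: space_gamma_matrix_measure)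
qed

lemma AE_gamma_matrix_measure:
  assumes "compact K" "K \<subseteq> {0..}" "0 < \<phi>" "0 < \<theta>"
  shows "AE u in gamma_matrix_measure m n \<phi> \<theta> K. \<forall>p\<in>{..<m} \<times> {..<n}. u p \<in> K"
proof -
  have K: "K \<in> sets borel"
    using assms(1) by (simp add: borel_compact)
  have "AE u in Pi\<^sub>M ({..<m} \<times> {..<n}) (\<lambda>_. lborel).
      0 < ennreal (indicator (mats m n K) (Matrix.mat m n u) * Gam (Matrix.mat m n u) \<phi> \<theta>)
        \<longrightarrow> (\<forall>p\<in>{..<m} \<times> {..<n}. u p \<in> K)"
    unfolding indicator_mats_Gam
  proof (intro AE_I2 impI ballI)
    fix u :: "nat \<times> nat \<Rightarrow> real" and p
    assume "0 < ennreal (\<Prod>p\<in>{..<m} \<times> {..<n}. indicator K (u p) * gamma_density \<phi> \<theta> (u p))"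
    then have nonzero: "(\<Prod>p\<in>{..<m} \<times> {..<n}. indicator K (u p) * gamma_density \<phi> \<theta> (u p)) \<noteq> 0"
      by (rule contrapos_pn) (simp only: ennreal_0 less_irrefl not_False_eq_True)
    assume p: "p \<in> {..<m} \<times> {..<n}"
    show "u p \<in> K"
    proof (rule ccontr)
      assume "u p \<notin> K"
      then have "(\<Prod>p\<in>{..<m} \<times> {..<n}. indicator K (u p) * gamma_density \<phi> \<theta> (u p)) = 0"
        using p by (intro prod_zero bexI[of _ p]) auto
      with nonzero show False
        by contradiction
    qed
  qed
  then show ?thesis
    unfolding gamma_matrix_measure_eq_density[OF assms]
    using indicator_mats_Gam_measurable[OF K] by (subst AE_density) auto
qed

text \<open>
  All volume estimates below reduce to one-dimensional ones through this formula.
\<close>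
lemma measure_gamma_matrix_boxes:
  assumes K: "compact K" "K \<subseteq> {0..}"
    and par: "0 < \<phi>" "0 < \<theta>" "0 < \<phi>'" "0 < \<theta>'"
    and A: "\<And>p. A p \<in> sets borel" and B: "\<And>p. B p \<in> sets borel"
  shows "measure (gamma_matrix_measure M H \<phi> \<theta> K \<Otimes>\<^sub>M gamma_matrix_measure H N \<phi>' \<theta>' K)
           (Pi\<^sub>E ({..<M} \<times> {..<H}) A \<times> Pi\<^sub>E ({..<H} \<times> {..<N}) B)
       = (\<Prod>p\<in>{..<M} \<times> {..<H}. measure (gamma_measure \<phi> \<theta> K) (A p))
         * (\<Prod>p\<in>{..<H} \<times> {..<N}. measure (gamma_measure \<phi>' \<theta>' K) (B p))"
proof -
  have one: "emeasure (gamma_matrix_measure m n f t K) (Pi\<^sub>E ({..<m} \<times> {..<n}) S)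
      = ennreal (\<Prod>p\<in>{..<m} \<times> {..<n}. measure (gamma_measure f t K) (S p))"
    if "0 < f" "0 < t" "\<And>p. S p \<in> sets borel" for m n f t and S :: "nat \<times> nat \<Rightarrow> real set"
  proof -
    interpret F: finite_measure "gamma_measure f t K"
      using K that by (intro finite_gamma_measure)
    interpret product_sigma_finite "\<lambda>_. gamma_measure f t K"
      by standard
    show ?thesis
      unfolding gamma_matrix_measure_def using that
      by (subst emeasure_PiM) (auto simp: F.emeasure_eq_measure prod_ennreal)
  qed
  interpret V: finite_measure "gamma_matrix_measure H N \<phi>' \<theta>' K"
    using K par by (intro finite_gamma_matrix_measure)
  show ?thesis
    using A B par
    by (intro measure_eq_emeasure_eq_ennreal, simp add: prod_nonneg,
        subst V.emeasure_pair_measure_Times)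
       (auto simp: one sets_gamma_matrix_measure prod_nonneg simp flip: ennreal_mult intro!: sets_PiM_I_finite)
qed

lemma nmf_loss_measurable_right:
  "(\<lambda>v. nmf_loss M N H W (u, v)) \<in> borel_measurable (Pi\<^sub>M ({..<H} \<times> {..<N}) (\<lambda>_. borel))"
proof -
  have [measurable]: "(\<lambda>v. v (k, j)) \<in> borel_measurable (Pi\<^sub>M ({..<H} \<times> {..<N}) (\<lambda>_. borel :: real measure))"
    if "k < H" "j < N" for j k
    using that by (intro measurable_component_singleton) simp
  show ?thesis
    unfolding nmf_loss_def prod.case
    by (intro borel_measurable_sum borel_measurable_power borel_measurable_diff
        borel_measurable_times borel_measurable_const) auto
qed

text \<open>
  The iterated integral over matrices becomes a single integral of \<open>f\<^sup>z\<close> against a finite measure, by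
  absorbing the prior into the measure and applying Fubini's theorem; the loss is bounded because \<open>K\<close>
  is.
\<close>
lemma nmf_zeta_eq_integral:
  fixes M N H :: nat
  assumes K: "compact K" "K \<subseteq> {0..}" and W: "W \<in> carrier_mat M N"
    and par: "0 < \<phi>" "0 < \<theta>" "0 < \<phi>'" "0 < \<theta>'"
  defines "P \<equiv> gamma_matrix_measure M H \<phi> \<theta> K \<Otimes>\<^sub>M gamma_matrix_measure H N \<phi>' \<theta>' K"
  obtains B where "0 < B" "AE p in P. nmf_loss M N H W p \<le> B"
    "\<And>z. 0 < Re z \<Longrightarrow> nmf_zeta M N H K W (gamma_prior \<phi> \<theta> \<phi>' \<theta>') z
       = (LINT p|P. complex_of_real (nmf_loss M N H W p) powr z)"
proof -
  let ?U = "gamma_matrix_measure M H \<phi> \<theta> K" and ?V = "gamma_matrix_measure H N \<phi>' \<theta>' K"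
  interpret U: finite_measure ?U
    using K par by (intro finite_gamma_matrix_measure)
  interpret V: finite_measure ?V
    using K par by (intro finite_gamma_matrix_measure)
  interpret UV: pair_sigma_finite ?U ?V
    by standard
  interpret P: finite_measure P
    unfolding P_def by (intro finite_measure_pair_measure) unfold_locales
  have meas [measurable]: "nmf_loss M N H W \<in> borel_measurable (?U \<Otimes>\<^sub>M ?V)"
    by (intro nmf_loss_measurable sets_gamma_matrix_measure)
  obtain R where R: "\<And>x. x \<in> K \<Longrightarrow> norm x \<le> R"
    using compact_imp_bounded[OF K(1)] by (auto simp: bounded_iff)
  define B where "B = (\<Sum>i<M. \<Sum>j<N. (real H * (R * R) + \<bar>W $$ (i, j)\<bar>)\<^sup>2) + 1"
  have bound: "nmf_loss M N H W (u, v) \<le> B"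
    if u: "\<forall>p\<in>{..<M} \<times> {..<H}. u p \<in> K" and v: "\<forall>p\<in>{..<H} \<times> {..<N}. v p \<in> K" for u v
  proof -
    have "((\<Sum>k<H. u (i, k) * v (k, j)) - W $$ (i, j))\<^sup>2 \<le> (real H * (R * R) + \<bar>W $$ (i, j)\<bar>)\<^sup>2"
      if ij: "i < M" "j < N" for i j
    proof -
      have "\<bar>u (i, k) * v (k, j)\<bar> \<le> R * R" if "k < H" for k
        using u v R[of "u (i, k)"] R[of "v (k, j)"] ij that by (auto simp: abs_mult intro!: mult_mono)
      then have "\<bar>\<Sum>k<H. u (i, k) * v (k, j)\<bar> \<le> real H * (R * R)"
        using sum_norm_le[of "{..<H}" "\<lambda>k. u (i, k) * v (k, j)" "\<lambda>_. R * R"] by auto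
      then have "\<bar>(\<Sum>k<H. u (i, k) * v (k, j)) - W $$ (i, j)\<bar> \<le> real H * (R * R) + \<bar>W $$ (i, j)\<bar>"
        by linarith
      then show ?thesis
        by (intro abs_le_square_iff[THEN iffD1] order.trans[OF _ abs_ge_self])
    qed
    then have "nmf_loss M N H W (u, v) \<le> (\<Sum>i<M. \<Sum>j<N. (real H * (R * R) + \<bar>W $$ (i, j)\<bar>)\<^sup>2)"
      unfolding nmf_loss_def by (auto intro!: sum_mono)
    then show ?thesis
      by (simp add: B_def)
  qed
  have "0 < B"
    unfolding B_def by (intro add_nonneg_pos sum_nonneg) auto
  have AE: "AE p in P. nmf_loss M N H W p \<le> B"
    unfolding P_def
  proof (rule UV.AE_pair_measure)
    show "AE u in ?U. AE v in ?V. nmf_loss M N H W (u, v) \<le> B"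
      using AE_gamma_matrix_measure[OF K par(1,2), of M H]
    proof eventually_elim
      case (elim u)
      show ?case
        using AE_gamma_matrix_measure[OF K par(3,4), of H N] by eventually_elim (use elim bound in auto)
    qed
  qed measurable
  have zeta: "nmf_zeta M N H K W (gamma_prior \<phi> \<theta> \<phi>' \<theta>') z
       = (LINT p|P. complex_of_real (nmf_loss M N H W p) powr z)" if z: "0 < Re z" for z
  proof -
    let ?F = "\<lambda>p. complex_of_real (nmf_loss M N H W p) powr z"
    define L where "L A V = complex_of_real ((frobenius_norm (A * V - W))\<^sup>2) powr z" for A V
    have L_eq: "L (Matrix.mat M H u) (Matrix.mat H N v) = ?F (u, v)" for u v
      by (simp add: L_def frobenius_norm_eq_nmf_loss[OF W])
    have F_meas: "?F \<in> borel_measurable (?U \<Otimes>\<^sub>M ?V)"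
      by (intro borel_measurable_of_real_powr meas nmf_loss_nonneg)
    have inner: "(LINT V:mats H N K|lborel_mat H N.
          L A V * complex_of_real (gamma_prior \<phi> \<theta> \<phi>' \<theta>' A V))
        = (LINT v|?V. L A (Matrix.mat H N v)) * complex_of_real (Gam A \<phi> \<theta>)"
      if "A \<in> mats M H K" for A
    proof -
      have "A = Matrix.mat M H (\<lambda>p. A $$ p)"
        using that by (intro eq_matI) (auto simp: mats_def)
      then obtain u where A: "A = Matrix.mat M H u"
        by blast
      have "(\<lambda>v. L A (Matrix.mat H N v) * complex_of_real (Gam A \<phi> \<theta>))
              \<in> borel_measurable (Pi\<^sub>M ({..<H} \<times> {..<N}) (\<lambda>_. borel))"
        unfolding A L_eq
        by (intro borel_measurable_times borel_measurable_const borel_measurable_of_real_powr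
            nmf_loss_measurable_right nmf_loss_nonneg)
      from integral_mats_Gam[OF K par(3,4), where F = "\<lambda>V. L A V * complex_of_real (Gam A \<phi> \<theta>)", OF this]
      show ?thesis
        by (simp add: gamma_prior_def mult_ac)
    qed
    have "nmf_zeta M N H K W (gamma_prior \<phi> \<theta> \<phi>' \<theta>') z
        = (LINT A:mats M H K|lborel_mat M H.
             (LINT v|?V. L A (Matrix.mat H N v)) * complex_of_real (Gam A \<phi> \<theta>))"
      unfolding nmf_zeta_def L_def[symmetric] set_lebesgue_integral_def[of _ "mats M H K"]
      by (intro Bochner_Integration.integral_cong refl) (auto simp: inner indicator_def)
    also have "\<dots> = (LINT u|?U. (LINT v|?V. L (Matrix.mat M H u) (Matrix.mat H N v)))"
    proof (rule integral_mats_Gam[OF K par(1,2)])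
      have "(\<lambda>u. LINT v|?V. ?F (u, v)) \<in> borel_measurable ?U"
        using F_meas by (intro V.borel_measurable_lebesgue_integral) simp
      then show "(\<lambda>u. LINT v|?V. L (Matrix.mat M H u) (Matrix.mat H N v))
                   \<in> borel_measurable (Pi\<^sub>M ({..<M} \<times> {..<H}) (\<lambda>_. borel))"
        unfolding L_eq by (subst (asm) measurable_cong_sets[OF sets_gamma_matrix_measure refl])
    qed
    also have "\<dots> = (LINT u|?U. (LINT v|?V. ?F (u, v)))"
      unfolding L_eq ..
    also have "\<dots> = (LINT p|P. ?F p)"
      unfolding P_def
    proof (rule UV.integral_fst')
      have "integrable P ?F"
      proof (rule P.integrable_const_bound[where B = "B powr Re z"])
        show "AE p in P. norm (?F p) \<le> B powr Re z"
          using AE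
        proof eventually_elim
          case (elim p)
          have "norm (?F p) = nmf_loss M N H W p powr Re z"
            using nmf_loss_nonneg[of M N H W p] by (simp add: norm_powr_real_powr)
          also have "\<dots> \<le> B powr Re z"
            using elim z nmf_loss_nonneg[of M N H W p] by (intro powr_mono2) auto
          finally show ?case .
        qed
      qed (use F_meas in \<open>simp add: P_def\<close>)
      then show "integrable (?U \<Otimes>\<^sub>M ?V) ?F"
        by (simp add: P_def)
    qed
    finally show ?thesis .
  qed
  show thesis
    by (rule that[OF \<open>0 < B\<close> AE zeta])
qed


section \<open>A lower bound for the volume of sublevel sets\<close>

text \<open>
  The two kinds of sides of the boxes used below: intervals of length of order \<open>\<eta>\<close> that stay away from
  \<open>0\<close>, and intervals of the form \<open>{x / 2<..x}\<close> with \<open>x\<close> of order \<open>\<eta> ^ p\<close>.  A common constant serves both.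
\<close>
lemma gamma_cells_lower_bound:
  assumes fin: "finite_measure (gamma_measure \<phi> \<theta> K)" and K: "K \<in> sets borel"
    and par: "0 < \<phi>" "0 < \<theta>" and ab: "0 < a" "a \<le> b" and \<delta>: "0 < \<delta>" "\<delta> \<le> 1"
  obtains c where "0 < c"
    "\<And>x y \<eta>. a \<le> x \<Longrightarrow> x + a * \<delta> * \<eta> \<le> y \<Longrightarrow> y \<le> b \<Longrightarrow> {x<..y} \<subseteq> K \<Longrightarrow> 0 < \<eta>
       \<Longrightarrow> c * \<eta> \<le> measure (gamma_measure \<phi> \<theta> K) {x<..y}"
    "\<And>x p \<eta>. {0..\<delta>} \<subseteq> K \<Longrightarrow> 0 < \<eta> \<Longrightarrow> \<eta> \<le> 1 \<Longrightarrow> x = \<delta> * \<eta> ^ p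
       \<Longrightarrow> c * \<eta> powr (real p * \<phi>) \<le> measure (gamma_measure \<phi> \<theta> K) {x / 2<..x}"
proof -
  obtain d where d: "0 < d" "\<And>x. a \<le> x \<Longrightarrow> x \<le> b \<Longrightarrow> d \<le> gamma_density \<phi> \<theta> x"
    using gamma_density_bounds[OF par ab] by metis
  obtain e where e: "0 < e"
    "\<And>x. 0 < x \<Longrightarrow> x \<le> 1 \<Longrightarrow> {0..x} \<subseteq> K \<Longrightarrow> e * x powr \<phi> \<le> measure (gamma_measure \<phi> \<theta> K) {x / 2<..x}"
    using gamma_measure_near_zero[OF fin K par] by metis
  show thesis
  proof (rule that[of "min (d * (a * \<delta>)) (e * \<delta> powr \<phi>)"])
    show "0 < min (d * (a * \<delta>)) (e * \<delta> powr \<phi>)"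
      using d e ab \<delta> by simp
  next
    fix x y \<eta> assume xy: "a \<le> x" "x + a * \<delta> * \<eta> \<le> y" "y \<le> b" "{x<..y} \<subseteq> K" "0 < \<eta>"
    have "0 < a * \<delta> * \<eta>"
      using xy ab \<delta> by simp
    then have "x \<le> y"
      using xy by linarith
    have "min (d * (a * \<delta>)) (e * \<delta> powr \<phi>) * \<eta> \<le> d * (a * \<delta>) * \<eta>"
      using xy by (intro mult_right_mono) auto
    also have "\<dots> = d * (a * \<delta> * \<eta>)"
      by simp
    also have "\<dots> \<le> d * (y - x)"
      using d(1) xy(2) by (intro mult_left_mono) auto
    also have "\<dots> \<le> measure (gamma_measure \<phi> \<theta> K) {x<..y}"
      using d xy \<open>x \<le> y\<close> by (intro gamma_measure_ge fin K) auto
    finally show "min (d * (a * \<delta>)) (e * \<delta> powr \<phi>) * \<eta> \<le> measure (gamma_measure \<phi> \<theta> K) {x<..y}" .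
  next
    fix x p \<eta> assume *: "{0..\<delta>} \<subseteq> K" "0 < \<eta>" "\<eta> \<le> 1" "x = \<delta> * \<eta> ^ p"
    then have x: "0 < x" "x \<le> \<delta>"
      using \<delta> by (auto simp: power_le_one mult_left_le)
    have "min (d * (a * \<delta>)) (e * \<delta> powr \<phi>) * \<eta> powr (real p * \<phi>) \<le> e * \<delta> powr \<phi> * \<eta> powr (real p * \<phi>)"
      by (intro mult_right_mono) auto
    also have "\<dots> = e * x powr \<phi>"
      using * \<delta> by (simp add: powr_mult powr_powr flip: powr_realpow)
    also have "\<dots> \<le> measure (gamma_measure \<phi> \<theta> K) {x / 2<..x}"
    proof (rule e)
      show "x \<le> 1" "{0..x} \<subseteq> K"
      using x \<delta> order.trans[OF _ *(1), of "{0..x}"] by simp_all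
    qed (rule x(1))
    finally show "min (d * (a * \<delta>)) (e * \<delta> powr \<phi>) * \<eta> powr (real p * \<phi>)
        \<le> measure (gamma_measure \<phi> \<theta> K) {x / 2<..x}" .
  qed
qed

text \<open>
  The error has a definite sign because the cells are placed above \<open>a t\<close> and \<open>b / t\<close>; this is what makes
  the loss strictly positive on the boxes.
\<close>
lemma cell_product_bounds:
  fixes a b t u v \<epsilon> :: real
  assumes "0 < a" "0 < b" "1 \<le> t" "0 < \<epsilon>" "\<epsilon> \<le> 1"
    and u: "a * t < u" "u \<le> a * (t + \<epsilon>)" and v: "b / t < v" "v \<le> b / t * (1 + \<epsilon>)"
  shows "a * b < u * v" and "u * v \<le> a * b + 3 * (a * b) * \<epsilon>"
proof -
  have ab: "a * t * (b / t) = a * b"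
    using assms(3) by simp
  have pos: "0 < a * t" "0 < b / t"
    using assms by auto
  show "a * b < u * v"
    unfolding ab[symmetric] using u(1) v(1) pos by (intro mult_strict_mono) auto
  have "a * \<epsilon> * 1 \<le> a * \<epsilon> * t"
    using assms by (intro mult_left_mono) auto
  then have "u \<le> a * t * (1 + \<epsilon>)"
    using u(2) by (simp add: algebra_simps)
  then have "u * v \<le> a * t * (1 + \<epsilon>) * (b / t * (1 + \<epsilon>))"
    using v pos u by (intro mult_mono) auto
  also have "\<dots> = a * t * (b / t) * (1 + \<epsilon>) * (1 + \<epsilon>)"
    by (simp only: mult_ac)
  also have "\<dots> = a * b * (1 + 2 * \<epsilon> + \<epsilon> * \<epsilon>)"
    unfolding ab by (simp add: algebra_simps)
  also have "\<dots> \<le> a * b * (1 + 2 * \<epsilon> + \<epsilon> * 1)"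
    using assms by (intro mult_left_mono add_left_mono) auto
  finally show "u * v \<le> a * b + 3 * (a * b) * \<epsilon>"
    by (simp add: algebra_simps)
qed

text \<open>
  In the application \<open>l i j k\<close> is the contribution of the \<open>k\<close>-th column and row to the entry \<open>(i, j)\<close> of the true
  matrix, which is \<open>0\<close> for the superfluous indices \<open>k\<close>.
\<close>
lemma nmf_loss_on_box:
  fixes l :: "nat \<Rightarrow> nat \<Rightarrow> nat \<Rightarrow> real"
  assumes "1 \<le> M" "1 \<le> N" "1 \<le> H"
    and W: "\<And>i j. i < M \<Longrightarrow> j < N \<Longrightarrow> W $$ (i, j) = (\<Sum>k<H. l i j k)"
    and lower: "\<And>i j k. i < M \<Longrightarrow> j < N \<Longrightarrow> k < H \<Longrightarrow> l i j k < u (i, k) * v (k, j)"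
    and upper: "\<And>i j k. i < M \<Longrightarrow> j < N \<Longrightarrow> k < H \<Longrightarrow> u (i, k) * v (k, j) \<le> l i j k + (3 * l i j k + 1) * \<epsilon>"
  shows "0 < nmf_loss M N H W (u, v)"
    and "nmf_loss M N H W (u, v) \<le> (\<Sum>i<M. \<Sum>j<N. (3 * W $$ (i, j) + real H)\<^sup>2) * \<epsilon>\<^sup>2"
proof -
  define e where "e i j = (\<Sum>k<H. u (i, k) * v (k, j)) - W $$ (i, j)" for i j
  have e: "0 < e i j" "e i j \<le> (3 * W $$ (i, j) + real H) * \<epsilon>" if "i < M" "j < N" for i j
  proof -
    have "(\<Sum>k<H. l i j k) < (\<Sum>k<H. u (i, k) * v (k, j))"
      using that assms(3) lower by (intro sum_strict_mono) (auto simp: lessThan_empty_iff)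
    then show "0 < e i j"
      using that by (simp add: e_def W)
    have "(\<Sum>k<H. u (i, k) * v (k, j)) \<le> (\<Sum>k<H. l i j k + (3 * l i j k + 1) * \<epsilon>)"
      using that upper by (intro sum_mono) auto
    also have "\<dots> = W $$ (i, j) + (3 * W $$ (i, j) + real H) * \<epsilon>"
      using that by (simp add: W sum.distrib sum_distrib_left sum_distrib_right algebra_simps)
    finally show "e i j \<le> (3 * W $$ (i, j) + real H) * \<epsilon>"
      by (simp add: e_def)
  qed
  have loss: "nmf_loss M N H W (u, v) = (\<Sum>i<M. \<Sum>j<N. (e i j)\<^sup>2)"
    by (simp add: nmf_loss_def e_def)
  show "0 < nmf_loss M N H W (u, v)"
    unfolding loss using assms(1,2)
    by (intro sum_pos zero_less_power e(1)) (auto simp: lessThan_empty_iff)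
  have "(\<Sum>i<M. \<Sum>j<N. (e i j)\<^sup>2) \<le> (\<Sum>i<M. \<Sum>j<N. ((3 * W $$ (i, j) + real H) * \<epsilon>)\<^sup>2)"
    using e by (intro sum_mono power_mono) (auto intro: less_imp_le)
  also have "\<dots> = (\<Sum>i<M. \<Sum>j<N. (3 * W $$ (i, j) + real H)\<^sup>2) * \<epsilon>\<^sup>2"
    by (simp add: power_mult_distrib sum_distrib_right)
  finally show "nmf_loss M N H W (u, v) \<le> (\<Sum>i<M. \<Sum>j<N. (3 * W $$ (i, j) + real H)\<^sup>2) * \<epsilon>\<^sup>2"
    unfolding loss .
qed

lemma interior_subset_pos:
  assumes "K \<subseteq> {0::real..}"
  shows "interior K \<subseteq> {0<..}"
  using interior_mono[OF assms] by simp

lemma scaling_room: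
  assumes K: "K \<subseteq> {0::real..}" and "finite E" "E \<subseteq> interior K"
    and zero: "P \<Longrightarrow> \<exists>\<epsilon>>0. {0..\<epsilon>} \<subseteq> K"
  obtains \<delta> where "0 < \<delta>" "\<delta> \<le> 1" "\<And>x. x \<in> E \<Longrightarrow> {x / (1 + \<delta>)..x * (1 + \<delta>)} \<subseteq> K"
    "P \<Longrightarrow> {0..\<delta>} \<subseteq> K"
proof -
  have "\<forall>\<^sub>F \<delta> in at_right 0. {x / (1 + \<delta>)..x * (1 + \<delta>)} \<subseteq> K" if x: "x \<in> E" for x
  proof -
    have "0 < x"
      using x assms(3) interior_subset_pos[OF K] by auto
    obtain r where r: "0 < r" "ball x r \<subseteq> K"
      using x assms(3) mem_interior[of x K] by auto
    have "{x / (1 + \<delta>)..x * (1 + \<delta>)} \<subseteq> K" if \<delta>: "0 < \<delta>" "\<delta> < r / x" for \<delta>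
    proof
      fix y assume y: "y \<in> {x / (1 + \<delta>)..x * (1 + \<delta>)}"
      have xr: "x * \<delta> < r"
        using \<delta> \<open>0 < x\<close> by (simp add: field_simps)
      have "x * (1 - \<delta>) \<le> x / (1 + \<delta>)"
        using \<delta> \<open>0 < x\<close> by (simp add: field_simps)
      then have "\<bar>y - x\<bar> < r"
        using y xr by (auto simp: algebra_simps)
      then show "y \<in> K"
        using r(2) by (auto simp: dist_real_def)
    qed
    moreover have "0 < r / x"
      using r \<open>0 < x\<close> by simp
    ultimately show ?thesis
      unfolding eventually_at_right_field by (intro exI[of _ "r / x"]) auto
  qed
  then have "\<forall>\<^sub>F \<delta> in at_right 0. \<forall>x\<in>E. {x / (1 + \<delta>)..x * (1 + \<delta>)} \<subseteq> K"
    using \<open>finite E\<close> by (simp add: eventually_ball_finite_distrib)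
  moreover have "\<forall>\<^sub>F \<delta> in at_right 0. P \<longrightarrow> {0..\<delta>} \<subseteq> K"
  proof (cases P)
    case True
    then obtain r where "0 < r" "{0..r} \<subseteq> K"
      using zero by blast
    then show ?thesis
      unfolding eventually_at_right_field by (intro exI[of _ r]) auto
  qed simp
  moreover have "\<forall>\<^sub>F \<delta>::real in at_right 0. 0 < \<delta> \<and> \<delta> \<le> 1"
    unfolding eventually_at_right_field by (intro exI[of _ 1]) auto
  ultimately have "\<forall>\<^sub>F \<delta> in at_right 0. (\<forall>x\<in>E. {x / (1 + \<delta>)..x * (1 + \<delta>)} \<subseteq> K)
      \<and> (P \<longrightarrow> {0..\<delta>} \<subseteq> K) \<and> 0 < \<delta> \<and> \<delta> \<le> 1"
    by eventually_elim simp
  from eventually_happens'[OF trivial_limit_at_right_real this]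
  obtain \<delta> where "(\<forall>x\<in>E. {x / (1 + \<delta>)..x * (1 + \<delta>)} \<subseteq> K)
      \<and> (P \<longrightarrow> {0..\<delta>} \<subseteq> K) \<and> 0 < \<delta> \<and> \<delta> \<le> 1" ..
  then show thesis
    by (intro that[of \<delta>]) auto
qed

lemma prod_powr_bound:
  fixes \<mu> :: "'a \<Rightarrow> real"
  assumes "finite S" "0 \<le> c" "0 < \<eta>" and "\<And>p. p \<in> S \<Longrightarrow> c * \<eta> powr e p \<le> \<mu> p"
  shows "c ^ card S * \<eta> powr (\<Sum>p\<in>S. e p) \<le> (\<Prod>p\<in>S. \<mu> p)"
proof -
  have "c ^ card S * \<eta> powr (\<Sum>p\<in>S. e p) = (\<Prod>p\<in>S. c * \<eta> powr e p)"
    using assms(1,3) by (simp add: prod.distrib powr_sum)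
  also have "\<dots> \<le> (\<Prod>p\<in>S. \<mu> p)"
    using assms by (intro prod_mono) auto
  finally show ?thesis .
qed

lemma sum_if_less_const:
  assumes "H0 \<le> H"
  shows "(\<Sum>k<H. if k < H0 then x else y) = real H0 * x + (real H - real H0) * (y::real)"
proof -
  have "{..<H} \<inter> {k. k < H0} = {..<H0}" "{..<H} \<inter> - {k. k < H0} = {H0..<H}"
    using assms by auto
  then show ?thesis
    using assms by (simp add: sum.If_cases of_nat_diff)
qed


text \<open>
  The exponents \<open>p\<close> and \<open>q\<close>, one of them \<open>1\<close> and the other \<open>0\<close>, say which of the superfluous columns of
  \<open>U\<close> and rows of \<open>V\<close> are made small.  For each choice \<open>m\<close> of a grid point \<open>m k < n\<close> for every
  \<open>k < H0\<close> there is a box around the factorization rescaled by \<open>t m k = 1 + m k * \<epsilon>\<close>.  Distinct boxes are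
  separated by the entries \<open>u (0, k)\<close>, so that their \<open>n ^ H0\<close> measures add up.
\<close>
lemma volume_lower_bound:
  fixes M N H H0 p q :: nat and a b :: "nat \<Rightarrow> nat \<Rightarrow> real"
  assumes dims: "1 \<le> M" "1 \<le> N" "1 \<le> H" "H0 \<le> H"
    and K: "compact K" "K \<subseteq> {0..}"
    and par: "0 < \<phi>" "0 < \<theta>" "0 < \<phi>'" "0 < \<theta>'"
    and a: "\<And>i k. i < M \<Longrightarrow> k < H0 \<Longrightarrow> a i k \<in> interior K"
    and b: "\<And>k j. k < H0 \<Longrightarrow> j < N \<Longrightarrow> b k j \<in> interior K"
    and W: "\<And>i j. i < M \<Longrightarrow> j < N \<Longrightarrow> W $$ (i, j) = (\<Sum>k<H0. a i k * b k j)"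
    and zero: "H0 < H \<Longrightarrow> \<exists>\<epsilon>>0. {0..\<epsilon>} \<subseteq> K"
    and pq: "p + q = 1"
  defines "P \<equiv> gamma_matrix_measure M H \<phi> \<theta> K \<Otimes>\<^sub>M gamma_matrix_measure H N \<phi>' \<theta>' K"
  obtains c C where "0 < c" "0 < C"
    "\<And>n. 1 \<le> n \<Longrightarrow>
       c * (1 / real n) powr (real H0 * (real M + real N - 1)
             + (real H - real H0) * (real p * (real M * \<phi>) + real q * (real N * \<phi>')))
         \<le> measure P {x \<in> space P. 0 < nmf_loss M N H W x \<and> nmf_loss M N H W x \<le> C * (1 / real n)\<^sup>2}"
proof -
  have K_borel: "K \<in> sets borel"
    using K(1) by (simp add: borel_compact)
  have fin: "finite_measure (gamma_measure \<phi> \<theta> K)" "finite_measure (gamma_measure \<phi>' \<theta>' K)"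
    using K par by (auto intro: finite_gamma_measure)
  interpret P: finite_measure P
    unfolding P_def using K par by (intro finite_measure_pair_measure finite_gamma_matrix_measure)
  define E where "E = (\<lambda>(i, k). a i k) ` ({..<M} \<times> {..<H0}) \<union> (\<lambda>(k, j). b k j) ` ({..<H0} \<times> {..<N})"
  have E: "finite E" "E \<subseteq> interior K"
    using a b by (auto simp: E_def)
  have a_E: "a i k \<in> E" if "i < M" "k < H0" for i k
    unfolding E_def using that by force
  have b_E: "b k j \<in> E" if "k < H0" "j < N" for k j
    unfolding E_def using that by force
  have E_pos: "0 < x" if "x \<in> E" for x
    using that E(2) interior_subset_pos[OF K(2)] by auto
  obtain \<delta> where \<delta>: "0 < \<delta>" "\<delta> \<le> 1"
    and room: "\<And>x. x \<in> E \<Longrightarrow> {x / (1 + \<delta>)..x * (1 + \<delta>)} \<subseteq> K"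
    and room0: "H0 < H \<Longrightarrow> {0..\<delta>} \<subseteq> K"
    by (rule scaling_room[OF K(2) E, of "H0 < H"]) (use zero in auto)
  define lo where "lo = Min (insert 1 ((\<lambda>x. x / (1 + \<delta>)) ` E))"
  define hi where "hi = Max (insert 1 ((\<lambda>x. x * (1 + \<delta>)) ` E))"
  have lo_le: "lo \<le> x / (1 + \<delta>)" and hi_ge: "x * (1 + \<delta>) \<le> hi" if "x \<in> E" for x
    unfolding lo_def hi_def using that E(1) by (auto intro!: Min_le Max_ge)
  have lo: "0 < lo" "lo \<le> hi"
  proof -
    show "0 < lo"
      unfolding lo_def using E(1) E_pos \<delta> by (subst Min_gr_iff) auto
    have "lo \<le> 1" "1 \<le> hi"
      unfolding lo_def hi_def using E(1) by (auto intro: Min_le Max_ge)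
    then show "lo \<le> hi"
      by linarith
  qed
  obtain cU where cU: "0 < cU"
    "\<And>x y \<eta>. lo \<le> x \<Longrightarrow> x + lo * \<delta> * \<eta> \<le> y \<Longrightarrow> y \<le> hi \<Longrightarrow> {x<..y} \<subseteq> K \<Longrightarrow> 0 < \<eta>
       \<Longrightarrow> cU * \<eta> \<le> measure (gamma_measure \<phi> \<theta> K) {x<..y}"
    "\<And>x p \<eta>. {0..\<delta>} \<subseteq> K \<Longrightarrow> 0 < \<eta> \<Longrightarrow> \<eta> \<le> 1 \<Longrightarrow> x = \<delta> * \<eta> ^ p
       \<Longrightarrow> cU * \<eta> powr (real p * \<phi>) \<le> measure (gamma_measure \<phi> \<theta> K) {x / 2<..x}"
    by (rule gamma_cells_lower_bound[OF fin(1) K_borel par(1,2) lo \<delta>]) blast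
  obtain cV where cV: "0 < cV"
    "\<And>x y \<eta>. lo \<le> x \<Longrightarrow> x + lo * \<delta> * \<eta> \<le> y \<Longrightarrow> y \<le> hi \<Longrightarrow> {x<..y} \<subseteq> K \<Longrightarrow> 0 < \<eta>
       \<Longrightarrow> cV * \<eta> \<le> measure (gamma_measure \<phi>' \<theta>' K) {x<..y}"
    "\<And>x p \<eta>. {0..\<delta>} \<subseteq> K \<Longrightarrow> 0 < \<eta> \<Longrightarrow> \<eta> \<le> 1 \<Longrightarrow> x = \<delta> * \<eta> ^ p
       \<Longrightarrow> cV * \<eta> powr (real p * \<phi>') \<le> measure (gamma_measure \<phi>' \<theta>' K) {x / 2<..x}"
    by (rule gamma_cells_lower_bound[OF fin(2) K_borel par(3,4) lo \<delta>]) blast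
  define S where "S = (\<Sum>i<M. \<Sum>j<N. (3 * W $$ (i, j) + real H)\<^sup>2)"
  define c where "c = cU ^ (M * H) * cV ^ (H * N)"
  define C where "C = S * \<delta>\<^sup>2 + 1"
  show thesis
  proof (rule that[of c C])
    show "0 < c"
      using cU cV by (simp add: c_def)
    have "0 \<le> S"
      unfolding S_def by (intro sum_nonneg) auto
    then show "0 < C"
      by (simp add: C_def add_nonneg_pos)
  next
    fix n :: nat assume n: "1 \<le> n"
    define \<eta> where "\<eta> = 1 / real n"
    define \<epsilon> where "\<epsilon> = \<delta> * \<eta>"
    have \<eta>: "0 < \<eta>" "\<eta> \<le> 1"
      using n by (auto simp: \<eta>_def)
    have \<epsilon>: "0 < \<epsilon>" "\<epsilon> \<le> \<delta>" "\<epsilon> \<le> 1" "real n * \<epsilon> = \<delta>"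
    proof -
      show "0 < \<epsilon>" "real n * \<epsilon> = \<delta>"
        using \<delta> \<eta> n by (auto simp: \<epsilon>_def \<eta>_def)
      show "\<epsilon> \<le> \<delta>"
        using \<delta> \<eta> by (simp add: \<epsilon>_def mult_left_le)
      then show "\<epsilon> \<le> 1"
        using \<delta> by linarith
    qed
    \<comment> \<open>The scaling factors stay within \<open>1 + \<delta>\<close>, as \<open>n * \<epsilon> = \<delta>\<close>, so all cells lie in \<open>K\<close>.\<close>
    define t where "t m k = 1 + real (m k) * \<epsilon>" for m :: "nat \<Rightarrow> nat" and k
    define A where "A m = (\<lambda>(i, k). if k < H0 then {a i k * t m k<..a i k * (t m k + \<epsilon>)}
        else {\<delta> * \<eta> ^ p / 2<..\<delta> * \<eta> ^ p})" for m
    define B where "B m = (\<lambda>(k, j). if k < H0 then {b k j / t m k<..b k j / t m k * (1 + \<epsilon>)}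
        else {\<delta> * \<eta> ^ q / 2<..\<delta> * \<eta> ^ q})" for m
    define T where "T = ({..<H0} \<rightarrow>\<^sub>E {..<n})"
    define box where "box m = Pi\<^sub>E ({..<M} \<times> {..<H}) (A m) \<times> Pi\<^sub>E ({..<H} \<times> {..<N}) (B m)" for m
    have t: "1 \<le> t m k" "t m k + \<epsilon> \<le> 1 + \<delta>" if "m \<in> T" "k < H0" for m k
    proof -
      show "1 \<le> t m k"
        using \<epsilon> by (simp add: t_def)
      have "real (Suc (m k)) \<le> real n"
        using that by (subst of_nat_le_iff) (auto simp: T_def PiE_iff Suc_le_eq)
      then have "real (Suc (m k)) * \<epsilon> \<le> real n * \<epsilon>"
        using \<epsilon> by (intro mult_right_mono) auto
      then show "t m k + \<epsilon> \<le> 1 + \<delta>"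
        using \<epsilon> by (simp add: t_def algebra_simps)
    qed
    have A_le: "cU * \<eta> powr (case x of (i, k) \<Rightarrow> if k < H0 then 1 else real p * \<phi>)
        \<le> measure (gamma_measure \<phi> \<theta> K) (A m x)" if m: "m \<in> T" and x: "x \<in> {..<M} \<times> {..<H}" for m x
    proof -
      obtain i k where ik: "x = (i, k)" "i < M" "k < H"
        using x by auto
      show ?thesis
      proof (cases "k < H0")
        case True
        note e = a_E[OF ik(2) True] and t = t[OF m True]
        note pos = E_pos[OF e]
        have "a i k / (1 + \<delta>) \<le> a i k"
          using pos \<delta> by (simp add: field_simps)
        then have "lo \<le> a i k"
          using lo_le[OF e] by linarith
        have "a i k * 1 \<le> a i k * t m k" "a i k * (t m k + \<epsilon>) \<le> a i k * (1 + \<delta>)"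
          using t pos by (intro mult_left_mono; simp)+
        moreover have "lo * \<epsilon> \<le> a i k * \<epsilon>"
          using \<open>lo \<le> a i k\<close> \<epsilon> by (intro mult_right_mono) auto
        ultimately have bounds: "a i k / (1 + \<delta>) \<le> a i k * t m k" "lo \<le> a i k * t m k"
            "a i k * t m k + lo * \<epsilon> \<le> a i k * (t m k + \<epsilon>)" "a i k * (t m k + \<epsilon>) \<le> a i k * (1 + \<delta>)"
          using \<open>a i k / (1 + \<delta>) \<le> a i k\<close> \<open>lo \<le> a i k\<close> by (auto simp: algebra_simps)
        have "{a i k * t m k<..a i k * (t m k + \<epsilon>)} \<subseteq> {a i k / (1 + \<delta>)..a i k * (1 + \<delta>)}"
          using bounds by auto
        then have "{a i k * t m k<..a i k * (t m k + \<epsilon>)} \<subseteq> K"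
          using room[OF e] by (rule order.trans)
        then have "cU * \<eta> \<le> measure (gamma_measure \<phi> \<theta> K) {a i k * t m k<..a i k * (t m k + \<epsilon>)}"
          using bounds hi_ge[OF e] \<eta> by (intro cU(2)) (auto simp: \<epsilon>_def mult.assoc)
        then show ?thesis
          using ik True \<eta> by (simp add: A_def)
      next
        case False
        then show ?thesis
          using ik \<eta> cU(3)[OF room0, of \<eta> "\<delta> * \<eta> ^ p" p] by (simp add: A_def)
      qed
    qed
    have B_le: "cV * \<eta> powr (case x of (k, j) \<Rightarrow> if k < H0 then 1 else real q * \<phi>')
        \<le> measure (gamma_measure \<phi>' \<theta>' K) (B m x)" if m: "m \<in> T" and x: "x \<in> {..<H} \<times> {..<N}" for m x
    proof -
      obtain k j where kj: "x = (k, j)" "k < H" "j < N"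
        using x by auto
      show ?thesis
      proof (cases "k < H0")
        case True
        note e = b_E[OF True kj(3)] and t = t[OF m True]
        note pos = E_pos[OF e]
        have "b k j / (1 + \<delta>) \<le> b k j / t m k" "b k j / t m k \<le> b k j / 1"
          using pos t \<epsilon> by (intro divide_left_mono mult_pos_pos; linarith)+
        then have "b k j / (1 + \<delta>) \<le> b k j / t m k" "b k j / t m k \<le> b k j"
          by simp_all
        moreover from this have "lo \<le> b k j / t m k"
          using lo_le[OF e] by linarith
        moreover from this have "lo * \<epsilon> \<le> b k j / t m k * \<epsilon>"
          using \<epsilon> by (intro mult_right_mono) auto
        moreover have "b k j / t m k * (1 + \<epsilon>) \<le> b k j * (1 + \<delta>)"
          using calculation(2) \<epsilon> pos by (intro mult_mono) auto
        ultimately have bounds: "b k j / (1 + \<delta>) \<le> b k j / t m k" "lo \<le> b k j / t m k"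
            "b k j / t m k + lo * \<epsilon> \<le> b k j / t m k * (1 + \<epsilon>)" "b k j / t m k * (1 + \<epsilon>) \<le> b k j * (1 + \<delta>)"
          by (auto simp: distrib_left)
        have "{b k j / t m k<..b k j / t m k * (1 + \<epsilon>)} \<subseteq> {b k j / (1 + \<delta>)..b k j * (1 + \<delta>)}"
          using bounds by auto
        then have "{b k j / t m k<..b k j / t m k * (1 + \<epsilon>)} \<subseteq> K"
          using room[OF e] by (rule order.trans)
        then have "cV * \<eta> \<le> measure (gamma_measure \<phi>' \<theta>' K) {b k j / t m k<..b k j / t m k * (1 + \<epsilon>)}"
          using bounds hi_ge[OF e] \<eta> by (intro cV(2)) (auto simp: \<epsilon>_def mult.assoc)
        then show ?thesis
          using kj True \<eta> by (simp add: B_def)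
      next
        case False
        then show ?thesis
          using kj \<eta> cV(3)[OF room0, of \<eta> "\<delta> * \<eta> ^ q" q] by (simp add: B_def)
      qed
    qed
    define eU where "eU = real M * (real H0 + (real H - real H0) * (real p * \<phi>))"
    define eV where "eV = real N * (real H0 + (real H - real H0) * (real q * \<phi>'))"
    have AB_borel: "A m x \<in> sets borel" "B m x \<in> sets borel" for m x
      by (auto simp: A_def B_def split: prod.splits)
    have box_measure: "c * \<eta> powr (eU + eV) \<le> measure P (box m)" if m: "m \<in> T" for m
    proof -
      have "cU ^ card ({..<M} \<times> {..<H})
              * \<eta> powr (\<Sum>x\<in>{..<M} \<times> {..<H}. case x of (i, k) \<Rightarrow> if k < H0 then 1 else real p * \<phi>)
            \<le> (\<Prod>x\<in>{..<M} \<times> {..<H}. measure (gamma_measure \<phi> \<theta> K) (A m x))"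
        using A_le[OF m] cU(1) \<eta>(1) by (intro prod_powr_bound) auto
      also have "(\<Sum>x\<in>{..<M} \<times> {..<H}. case x of (i, k) \<Rightarrow> if k < H0 then 1 else real p * \<phi>) = eU"
        by (subst sum.cartesian_product[symmetric]) (simp add: sum_if_less_const[OF dims(4)] eU_def)
      finally have U: "cU ^ (M * H) * \<eta> powr eU
            \<le> (\<Prod>x\<in>{..<M} \<times> {..<H}. measure (gamma_measure \<phi> \<theta> K) (A m x))"
        by simp
      have "cV ^ card ({..<H} \<times> {..<N})
              * \<eta> powr (\<Sum>x\<in>{..<H} \<times> {..<N}. case x of (k, j) \<Rightarrow> if k < H0 then 1 else real q * \<phi>')
            \<le> (\<Prod>x\<in>{..<H} \<times> {..<N}. measure (gamma_measure \<phi>' \<theta>' K) (B m x))"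
        using B_le[OF m] cV(1) \<eta>(1) by (intro prod_powr_bound) auto
      also have "(\<Sum>x\<in>{..<H} \<times> {..<N}. case x of (k, j) \<Rightarrow> if k < H0 then 1 else real q * \<phi>') = eV"
        by (subst sum.cartesian_product[symmetric])
           (simp only: sum_constant card_lessThan sum_distrib_left[symmetric]
              sum_if_less_const[OF dims(4)] eV_def mult_1_right)
      finally have V: "cV ^ (H * N) * \<eta> powr eV
            \<le> (\<Prod>x\<in>{..<H} \<times> {..<N}. measure (gamma_measure \<phi>' \<theta>' K) (B m x))"
        by simp
      have "c * \<eta> powr (eU + eV) = cU ^ (M * H) * \<eta> powr eU * (cV ^ (H * N) * \<eta> powr eV)"
        by (simp add: c_def powr_add)
      also have "\<dots> \<le> (\<Prod>x\<in>{..<M} \<times> {..<H}. measure (gamma_measure \<phi> \<theta> K) (A m x))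
          * (\<Prod>x\<in>{..<H} \<times> {..<N}. measure (gamma_measure \<phi>' \<theta>' K) (B m x))"
        using U V cU(1) cV(1) by (intro mult_mono prod_nonneg) auto
      also have "\<dots> = measure P (box m)"
        unfolding P_def box_def
        by (rule measure_gamma_matrix_boxes[OF K par, symmetric]) (rule AB_borel)+
      finally show ?thesis .
    qed
    define Z where "Z = {x \<in> space P. 0 < nmf_loss M N H W x \<and> nmf_loss M N H W x \<le> C * \<eta>\<^sup>2}"
    have box_subset: "box m \<subseteq> Z" if m: "m \<in> T" for m
    proof
      fix x assume x: "x \<in> box m"
      then obtain u v where uv: "x = (u, v)" "u \<in> Pi\<^sub>E ({..<M} \<times> {..<H}) (A m)"
          "v \<in> Pi\<^sub>E ({..<H} \<times> {..<N}) (B m)"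
        by (auto simp: box_def)
      define l where "l i j k = (if k < H0 then a i k * b k j else 0)" for i j k
      have cell: "l i j k < u (i, k) * v (k, j) \<and> u (i, k) * v (k, j) \<le> l i j k + (3 * l i j k + 1) * \<epsilon>"
        if ijk: "i < M" "j < N" "k < H" for i j k
      proof -
        have u: "u (i, k) \<in> A m (i, k)" and v: "v (k, j) \<in> B m (k, j)"
          using uv ijk by auto
        show ?thesis
        proof (cases "k < H0")
          case True
          have "a i k * b k j < u (i, k) * v (k, j)"
            and "u (i, k) * v (k, j) \<le> a i k * b k j + 3 * (a i k * b k j) * \<epsilon>"
            using cell_product_bounds[OF E_pos[OF a_E] E_pos[OF b_E] t(1)[OF m True] \<epsilon>(1,3),
                of i k k j "u (i, k)" "v (k, j)"] True ijk u v
            by (auto simp: A_def B_def)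
          then show ?thesis
            using True \<epsilon>(1) by (simp add: l_def algebra_simps)
        next
          case False
          then have u': "\<delta> * \<eta> ^ p / 2 < u (i, k)" "u (i, k) \<le> \<delta> * \<eta> ^ p"
            and v': "\<delta> * \<eta> ^ q / 2 < v (k, j)" "v (k, j) \<le> \<delta> * \<eta> ^ q"
            using u v by (auto simp: A_def B_def)
          have half_pos: "0 < \<delta> * \<eta> ^ p / 2" "0 < \<delta> * \<eta> ^ q / 2"
            using \<delta>(1) \<eta>(1) by auto
          then have uv_pos: "0 < u (i, k)" "0 < v (k, j)"
            using u'(1) v'(1) by linarith+
          have "u (i, k) * v (k, j) \<le> \<delta> * \<eta> ^ p * (\<delta> * \<eta> ^ q)"
            using u' v' uv_pos by (intro mult_mono) auto
          also have "\<dots> = \<delta> * \<delta> * \<eta> ^ (p + q)"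
            by (simp add: power_add)
          also have "\<dots> = \<delta> * \<epsilon>"
            by (simp add: pq \<epsilon>_def)
          also have "\<dots> \<le> 1 * \<epsilon>"
            using \<delta> \<epsilon> by (intro mult_right_mono) auto
          finally show ?thesis
            using False uv_pos by (simp add: l_def)
        qed
      qed
      have W': "W $$ (i, j) = (\<Sum>k<H. l i j k)" if "i < M" "j < N" for i j
      proof -
        have "(\<Sum>k<H. l i j k) = (\<Sum>k<H0. a i k * b k j)"
          using dims(4) by (intro sum.mono_neutral_cong_right) (auto simp: l_def)
        then show ?thesis
          using W[OF that] by simp
      qed
      note loss = nmf_loss_on_box[OF dims(1-3), of W l u v \<epsilon>, OF W']
      have "nmf_loss M N H W x \<le> S * \<epsilon>\<^sup>2"
        unfolding uv(1) S_def using cell by (intro loss(2)) auto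
      also have "\<dots> = S * \<delta>\<^sup>2 * \<eta>\<^sup>2"
        by (simp add: \<epsilon>_def power_mult_distrib)
      also have "\<dots> \<le> C * \<eta>\<^sup>2"
        unfolding C_def by (intro mult_right_mono) auto
      finally have "nmf_loss M N H W x \<le> C * \<eta>\<^sup>2" .
      moreover have "0 < nmf_loss M N H W x"
        unfolding uv(1) using cell by (intro loss(1)) auto
      moreover have "x \<in> space P"
        using uv by (auto simp: P_def space_pair_measure space_gamma_matrix_measure PiE_iff)
      ultimately show "x \<in> Z"
        by (simp add: Z_def)
    qed
    have "disjoint_family_on box T"
    proof -
      have cell_disjoint: False
        if m: "m \<in> T" "m' \<in> T" "x \<in> box m" "x \<in> box m'" and k: "k < H0" "m k < m' k" for m m' x k
      proof -
        have "(0, k) \<in> {..<M} \<times> {..<H}"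
          using dims k by auto
        then have "fst x (0, k) \<in> A m (0, k)" "fst x (0, k) \<in> A m' (0, k)"
          using m(3,4) by (auto simp: box_def)
        then have x: "fst x (0, k) \<le> a 0 k * (t m k + \<epsilon>)" "a 0 k * t m' k < fst x (0, k)"
          using k by (auto simp: A_def)
        have "real (m k) + 1 \<le> real (m' k)"
          using k by linarith
        then have "(real (m k) + 1) * \<epsilon> \<le> real (m' k) * \<epsilon>"
          using \<epsilon> by (intro mult_right_mono) auto
        then have "t m k + \<epsilon> \<le> t m' k"
          by (simp add: t_def algebra_simps)
        moreover have "0 < a 0 k"
          using dims k by (intro E_pos a_E) auto
        ultimately have "a 0 k * (t m k + \<epsilon>) \<le> a 0 k * t m' k"
          by (intro mult_left_mono) auto
        then show False
          using x by linarith
      qed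
      show ?thesis
        unfolding disjoint_family_on_def
      proof (intro ballI impI)
        fix m m' assume m: "m \<in> T" "m' \<in> T" "m \<noteq> m'"
        obtain k where k: "k < H0" "m k \<noteq> m' k"
        proof (rule ccontr)
          assume *: "\<not> thesis"
          have "m = m'"
            by (rule PiE_ext[OF m(1,2)[unfolded T_def]]) (use * that in auto)
          then show False
            using m(3) by contradiction
        qed
        show "box m \<inter> box m' = {}"
        proof (rule ccontr)
          assume "box m \<inter> box m' \<noteq> {}"
          then obtain x where "x \<in> box m" "x \<in> box m'"
            by auto
          then show False
            using cell_disjoint[of m m' x k] cell_disjoint[of m' m x k] m k by linarith
        qed
      qed
    qed
    moreover have "finite T"
      unfolding T_def by (intro finite_PiE) auto
    moreover have box_sets: "box m \<in> sets P" for m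
      unfolding box_def P_def using AB_borel
      by (intro pair_measureI) (auto simp: sets_gamma_matrix_measure intro!: sets_PiM_I_finite)
    ultimately have union: "measure P (\<Union>m\<in>T. box m) = (\<Sum>m\<in>T. measure P (box m))"
      by (intro P.finite_measure_finite_Union) auto
    have [measurable]: "nmf_loss M N H W \<in> borel_measurable P"
      unfolding P_def by (intro nmf_loss_measurable sets_gamma_matrix_measure)
    have "Z \<in> sets P"
      unfolding Z_def by measurable
    have "real (card T) = \<eta> powr (- real H0)"
      using n by (simp add: T_def card_PiE \<eta>_def powr_minus powr_realpow powr_divide)
    then have "c * \<eta> powr (eU + eV - real H0) = real (card T) * (c * \<eta> powr (eU + eV))"
      by (simp add: powr_diff powr_minus field_simps)
    also have "\<dots> \<le> (\<Sum>m\<in>T. measure P (box m))"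
      using box_measure by (intro sum_bounded_below)
    also have "\<dots> = measure P (\<Union>m\<in>T. box m)"
      by (rule union[symmetric])
    also have "\<dots> \<le> measure P Z"
      using box_subset \<open>Z \<in> sets P\<close> by (intro P.finite_measure_mono) auto
    finally have "c * \<eta> powr (eU + eV - real H0) \<le> measure P Z" .
    moreover have "eU + eV - real H0 = real H0 * (real M + real N - 1)
             + (real H - real H0) * (real p * (real M * \<phi>) + real q * (real N * \<phi>'))"
      by (simp add: eU_def eV_def algebra_simps)
    ultimately show "c * (1 / real n) powr (real H0 * (real M + real N - 1)
             + (real H - real H0) * (real p * (real M * \<phi>) + real q * (real N * \<phi>')))
         \<le> measure P {x \<in> space P. 0 < nmf_loss M N H W x \<and> nmf_loss M N H W x \<le> C * (1 / real n)\<^sup>2}"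
      by (simp add: Z_def \<eta>_def)
  qed
qed


section \<open>An upper bound for the volume in rank one\<close>

text \<open>
  Two entries of one column of \<open>u v\<^sup>T\<close> have the ratio of the corresponding entries of \<open>u\<close>; if \<open>v\<close> is
  bounded below, then \<open>u\<^sub>0\<close>, known to be within \<open>\<epsilon>\<close> of \<open>x\<close>, determines \<open>u\<close> up to order \<open>\<epsilon>\<close>.
\<close>
lemma left_factor_localization:
  fixes u v u\<^sub>0 x a a\<^sub>0 b \<alpha> \<rho> \<epsilon> :: real
  assumes "\<bar>u * v - a * b\<bar> \<le> \<epsilon>" "\<bar>u\<^sub>0 * v - a\<^sub>0 * b\<bar> \<le> \<epsilon>"
    and "0 < \<alpha>" "\<alpha> \<le> v" "0 < a\<^sub>0" "0 < a" "a / a\<^sub>0 \<le> \<rho>" "\<bar>u\<^sub>0 - x\<bar> \<le> \<epsilon>"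
  shows "\<bar>u - x * (a / a\<^sub>0)\<bar> \<le> ((1 + \<rho>) / \<alpha> + \<rho>) * \<epsilon>"
proof -
  define s where "s = a / a\<^sub>0"
  have s: "0 < s" "s \<le> \<rho>" "a = s * a\<^sub>0"
    using assms by (auto simp: s_def)
  have "0 \<le> \<epsilon>"
    using assms(1) by linarith
  have "\<bar>v * (u - u\<^sub>0 * s)\<bar> = \<bar>(u * v - a * b) - s * (u\<^sub>0 * v - a\<^sub>0 * b)\<bar>"
    by (simp add: s(3) algebra_simps)
  also have "\<dots> \<le> \<bar>u * v - a * b\<bar> + s * \<bar>u\<^sub>0 * v - a\<^sub>0 * b\<bar>"
    using s(1) abs_triangle_ineq4[of "u * v - a * b" "s * (u\<^sub>0 * v - a\<^sub>0 * b)"] by (simp add: abs_mult)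
  also have "\<dots> \<le> \<epsilon> + s * \<epsilon>"
    using assms s(1) by (intro add_mono mult_left_mono) auto
  also have "\<dots> \<le> \<epsilon> + \<rho> * \<epsilon>"
    using s \<open>0 \<le> \<epsilon>\<close> by (intro add_left_mono mult_right_mono) auto
  finally have "\<alpha> * \<bar>u - u\<^sub>0 * s\<bar> \<le> (1 + \<rho>) * \<epsilon>"
    using assms(3,4) mult_right_mono[of \<alpha> v "\<bar>u - u\<^sub>0 * s\<bar>"] by (simp add: abs_mult distrib_right)
  then have "\<bar>u - u\<^sub>0 * s\<bar> \<le> (1 + \<rho>) / \<alpha> * \<epsilon>"
    using assms(3) by (simp add: field_simps)
  moreover have "\<bar>u\<^sub>0 * s - x * s\<bar> \<le> \<rho> * \<epsilon>"
  proof -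
    have "\<bar>u\<^sub>0 * s - x * s\<bar> = s * \<bar>u\<^sub>0 - x\<bar>"
      using s(1) by (simp add: left_diff_distrib[symmetric] abs_mult)
    also have "\<dots> \<le> \<rho> * \<epsilon>"
      using s assms by (intro mult_mono) auto
    finally show ?thesis .
  qed
  ultimately show ?thesis
    unfolding s_def[symmetric] distrib_right by linarith
qed

lemma right_factor_localization:
  fixes u v y c \<alpha> \<beta> \<epsilon> :: real
  assumes "\<bar>u * v - c\<bar> \<le> \<epsilon>" "0 < \<alpha>" "\<alpha> \<le> u" "u \<le> y" "y \<le> u + \<epsilon>" "0 < c" "c \<le> \<beta>"
  shows "\<bar>v - c / y\<bar> \<le> (1 / \<alpha> + \<beta> / \<alpha>\<^sup>2) * \<epsilon>"
proof -
  have pos: "0 < u" "0 < y" "0 \<le> \<epsilon>"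
    using assms by linarith+
  have "v - c / u = (u * v - c) / u"
    using pos by (simp add: field_simps)
  then have "\<bar>v - c / u\<bar> = \<bar>u * v - c\<bar> / u"
    using pos by (simp add: abs_divide)
  also have "\<dots> \<le> \<epsilon> / \<alpha>"
    using assms by (intro frac_le) auto
  finally have "\<bar>v - c / u\<bar> \<le> 1 / \<alpha> * \<epsilon>"
    by simp
  moreover have "\<bar>c / u - c / y\<bar> \<le> \<beta> / \<alpha>\<^sup>2 * \<epsilon>"
  proof -
    have "c / u - c / y = c * (y - u) / (u * y)"
      using pos by (simp add: field_simps)
    then have "\<bar>c / u - c / y\<bar> = c * (y - u) / (u * y)"
      using pos assms by simp
    also have "\<dots> \<le> \<beta> * \<epsilon> / (\<alpha> * \<alpha>)"
      using pos assms by (intro frac_le mult_mono) auto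
    finally show ?thesis
      by (simp add: power2_eq_square)
  qed
  ultimately show ?thesis
    unfolding distrib_right by linarith
qed

lemma AE_gamma_pair_measure:
  assumes K: "compact K" "K \<subseteq> {0..}"
    and par: "0 < \<phi>" "0 < \<theta>" "0 < \<phi>'" "0 < \<theta>'"
  shows "AE x in gamma_matrix_measure M H \<phi> \<theta> K \<Otimes>\<^sub>M gamma_matrix_measure H N \<phi>' \<theta>' K.
    (\<forall>p\<in>{..<M} \<times> {..<H}. fst x p \<in> K) \<and> (\<forall>p\<in>{..<H} \<times> {..<N}. snd x p \<in> K)"
proof -
  let ?U = "gamma_matrix_measure M H \<phi> \<theta> K" and ?V = "gamma_matrix_measure H N \<phi>' \<theta>' K"
  interpret U: finite_measure ?U
    using K par by (intro finite_gamma_matrix_measure)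
  interpret V: finite_measure ?V
    using K par by (intro finite_gamma_matrix_measure)
  interpret UV: pair_sigma_finite ?U ?V
    by standard
  have "K \<in> sets borel"
    using K(1) by (simp add: borel_compact)
  then have "Pi\<^sub>E ({..<M} \<times> {..<H}) (\<lambda>_. K) \<times> Pi\<^sub>E ({..<H} \<times> {..<N}) (\<lambda>_. K) \<in> sets (?U \<Otimes>\<^sub>M ?V)"
    by (intro pair_measureI) (auto simp: sets_gamma_matrix_measure intro!: sets_PiM_I_finite)
  also have "Pi\<^sub>E ({..<M} \<times> {..<H}) (\<lambda>_. K) \<times> Pi\<^sub>E ({..<H} \<times> {..<N}) (\<lambda>_. K)
      = {x \<in> space (?U \<Otimes>\<^sub>M ?V). (\<forall>p\<in>{..<M} \<times> {..<H}. fst x p \<in> K) \<and> (\<forall>p\<in>{..<H} \<times> {..<N}. snd x p \<in> K)}"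
    by (auto simp: space_pair_measure space_gamma_matrix_measure PiE_iff)
  finally show ?thesis
  proof (rule UV.AE_pair_measure)
    show "AE u in ?U. AE v in ?V. (\<forall>p\<in>{..<M} \<times> {..<H}. fst (u, v) p \<in> K) \<and> (\<forall>p\<in>{..<H} \<times> {..<N}. snd (u, v) p \<in> K)"
      using AE_gamma_matrix_measure[OF K par(1,2), of M H]
    proof eventually_elim
      case (elim u)
      show ?case
        using AE_gamma_matrix_measure[OF K par(3,4), of H N] by eventually_elim (use elim in simp)
    qed
  qed
qed

lemma residual_le_sqrt_nmf_loss:
  assumes "i < M" "j < N"
  shows "\<bar>(\<Sum>k<H. u (i, k) * v (k, j)) - W $$ (i, j)\<bar> \<le> sqrt (nmf_loss M N H W (u, v))"
proof (rule real_le_rsqrt)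
  define e where "e i j = (\<Sum>k<H. u (i, k) * v (k, j)) - W $$ (i, j)" for i j
  have "(e i j)\<^sup>2 \<le> (\<Sum>j<N. (e i j)\<^sup>2)"
    using assms by (intro member_le_sum) auto
  also have "\<dots> \<le> (\<Sum>i<M. \<Sum>j<N. (e i j)\<^sup>2)"
    using assms by (intro member_le_sum[of i "{..<M}" "\<lambda>i. \<Sum>j<N. (e i j)\<^sup>2"]) (auto intro: sum_nonneg)
  also have "\<dots> = nmf_loss M N H W (u, v)"
    by (simp add: nmf_loss_def e_def)
  finally show "\<bar>(\<Sum>k<H. u (i, k) * v (k, j)) - W $$ (i, j)\<bar>\<^sup>2 \<le> nmf_loss M N H W (u, v)"
    by (simp add: e_def)
qed

text \<open>
  The interval \<open>{0..R}\<close> containing \<open>K\<close> is cut into cells of length \<open>\<epsilon> = sqrt r\<close>, and the cell of the first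
  entry of \<open>u\<close> confines all entries to intervals of length of order \<open>\<epsilon>\<close>.  Every entry is at least
  \<open>\<alpha> = w / (2 * R)\<close>: if \<open>w\<close> is the least entry of the true matrix and \<open>\<epsilon> \<le> w / 2\<close>, then
  \<open>u\<^sub>i v\<^sub>j \<ge> w / 2\<close>, while both factors are at most \<open>R\<close>.
\<close>
lemma volume_upper_bound_rank_one:
  fixes M N :: nat and a b :: "nat \<Rightarrow> real"
  assumes dims: "1 \<le> M" "1 \<le> N"
    and K: "compact K" "K \<subseteq> {0..}"
    and par: "0 < \<phi>" "0 < \<theta>" "0 < \<phi>'" "0 < \<theta>'"
    and a: "\<And>i. i < M \<Longrightarrow> 0 < a i" and b: "\<And>j. j < N \<Longrightarrow> 0 < b j"
    and W: "\<And>i j. i < M \<Longrightarrow> j < N \<Longrightarrow> W $$ (i, j) = a i * b j"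
  defines "P \<equiv> gamma_matrix_measure M 1 \<phi> \<theta> K \<Otimes>\<^sub>M gamma_matrix_measure 1 N \<phi>' \<theta>' K"
  obtains C \<eta> where "0 < \<eta>"
    "\<And>r. 0 < r \<Longrightarrow> r \<le> \<eta> \<Longrightarrow>
       measure P {x \<in> space P. 0 < nmf_loss M N 1 W x \<and> nmf_loss M N 1 W x \<le> r}
         \<le> C * r powr ((real M + real N - 1) / 2)"
proof -
  have K_borel: "K \<in> sets borel"
    using K(1) by (simp add: borel_compact)
  have fin: "finite_measure (gamma_measure \<phi> \<theta> K)" "finite_measure (gamma_measure \<phi>' \<theta>' K)"
    using K par by (auto intro: finite_gamma_measure)
  interpret P: finite_measure P
    unfolding P_def using K par by (intro finite_measure_pair_measure finite_gamma_matrix_measure)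
  obtain R0 where R0: "\<And>x. x \<in> K \<Longrightarrow> norm x \<le> R0"
    using compact_imp_bounded[OF K(1)] by (auto simp: bounded_iff)
  define R where "R = max 1 R0"
  have R: "1 \<le> R" "0 < R" "\<And>x. x \<in> K \<Longrightarrow> 0 \<le> x \<and> x \<le> R"
    using R0 K(2) by (force simp: R_def)+
  define w where "w = Min ((\<lambda>(i, j). a i * b j) ` ({..<M} \<times> {..<N}))"
  have w_le: "w \<le> a i * b j" if "i < M" "j < N" for i j
    unfolding w_def using that by (intro Min_le) force+
  have ne: "{..<M} \<times> {..<N} \<noteq> {}"
    using dims by (auto simp: lessThan_empty_iff)
  have "0 < w"
    unfolding w_def using ne a b by (subst Min_gr_iff) auto
  define \<alpha> where "\<alpha> = w / (2 * R)"
  have "0 < \<alpha>"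
    using \<open>0 < w\<close> R by (simp add: \<alpha>_def)
  obtain DU where DU: "0 < DU" "\<And>x. \<alpha> \<le> x \<Longrightarrow> x \<le> max \<alpha> R \<Longrightarrow> gamma_density \<phi> \<theta> x \<le> DU"
    by (rule gamma_density_bounds[OF par(1,2) \<open>0 < \<alpha>\<close>, of "max \<alpha> R"]) auto
  obtain DV where DV: "0 < DV" "\<And>x. \<alpha> \<le> x \<Longrightarrow> x \<le> max \<alpha> R \<Longrightarrow> gamma_density \<phi>' \<theta>' x \<le> DV"
    by (rule gamma_density_bounds[OF par(3,4) \<open>0 < \<alpha>\<close>, of "max \<alpha> R"]) auto
  define \<rho> where "\<rho> = (\<Sum>i<M. a i / a 0)"
  have a0: "0 < a 0" and b0: "0 < b 0"
    using a[of 0] b[of 0] dims by auto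
  have \<rho>: "a i / a 0 \<le> \<rho>" if "i < M" for i
    unfolding \<rho>_def using that a a0
    by (intro member_le_sum[of i "{..<M}" "\<lambda>i. a i / a 0"]) (auto intro: divide_nonneg_pos less_imp_le)
  define \<beta> where "\<beta> = (\<Sum>j<N. a 0 * b j)"
  have \<beta>: "a 0 * b j \<le> \<beta>" if "j < N" for j
    unfolding \<beta>_def using that b a0
    by (intro member_le_sum[of j "{..<N}" "\<lambda>j. a 0 * b j"]) (auto intro: less_imp_le)
  have \<rho>0: "0 \<le> \<rho>" and \<beta>0: "0 \<le> \<beta>"
    using \<rho>[of 0] \<beta>[of 0] a0 b0 dims by (auto intro: order.trans[rotated])
  define CU where "CU = (1 + \<rho>) / \<alpha> + \<rho>"
  define CV where "CV = 1 / \<alpha> + \<beta> / \<alpha>\<^sup>2"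
  have C_nonneg: "0 \<le> CU" "0 \<le> CV"
    using \<open>0 < \<alpha>\<close> \<rho>0 \<beta>0 by (auto simp: CU_def CV_def)
  define E where "E = (2 * DU * CU) ^ M * (2 * DV * CV) ^ N"
  have "0 \<le> E"
    using C_nonneg DU(1) DV(1) by (simp add: E_def)
  define \<eta> where "\<eta> = (min (w / 2) 1)\<^sup>2"
  show thesis
  proof (rule that[of \<eta> "(R + 2) * E"])
    show "0 < \<eta>"
      using \<open>0 < w\<close> by (simp add: \<eta>_def)
  next
    fix r :: real assume r: "0 < r" "r \<le> \<eta>"
    define \<epsilon> where "\<epsilon> = sqrt r"
    have \<epsilon>: "0 < \<epsilon>" "\<epsilon> \<le> w / 2" "\<epsilon> \<le> 1"
    proof -
      show "0 < \<epsilon>"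
        using r by (simp add: \<epsilon>_def)
      have "\<epsilon> \<le> min (w / 2) 1"
        unfolding \<epsilon>_def using r(2) \<open>0 < w\<close> by (intro real_le_lsqrt) (auto simp: \<eta>_def)
      then show "\<epsilon> \<le> w / 2" "\<epsilon> \<le> 1"
        by auto
    qed
    define n where "n = nat \<lfloor>R / \<epsilon>\<rfloor> + 1"
    define A where "A m = (\<lambda>(i, k::nat). {\<alpha>..} \<inter>
        {real m * \<epsilon> * (a i / a 0) - CU * \<epsilon>..real m * \<epsilon> * (a i / a 0) + CU * \<epsilon>})" for m :: nat
    define B where "B m = (\<lambda>(k::nat, j). {\<alpha>..} \<inter>
        {a 0 * b j / (real (Suc m) * \<epsilon>) - CV * \<epsilon>..a 0 * b j / (real (Suc m) * \<epsilon>) + CV * \<epsilon>})" for m :: nat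
    define box where "box m = Pi\<^sub>E ({..<M} \<times> {..<1}) (A m) \<times> Pi\<^sub>E ({..<1} \<times> {..<N}) (B m)" for m
    define Z where "Z = {x \<in> space P. 0 < nmf_loss M N 1 W x \<and> nmf_loss M N 1 W x \<le> r}"
    have AB_borel: "A m x \<in> sets borel" "B m x \<in> sets borel" for m x
      by (auto simp: A_def B_def split: prod.splits)
    have A_le: "measure (gamma_measure \<phi> \<theta> K) (A m x) \<le> 2 * DU * CU * \<epsilon>" for m x
    proof -
      obtain i k where x: "x = (i, k)"
        by (cases x)
      have "measure (gamma_measure \<phi> \<theta> K) (A m x) \<le> DU * ((real m * \<epsilon> * (a i / a 0) + CU * \<epsilon>)
          - (real m * \<epsilon> * (a i / a 0) - CU * \<epsilon>))"
      proof (rule gamma_measure_le[OF fin(1) K_borel AB_borel(1)])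
        show "A m x \<subseteq> {real m * \<epsilon> * (a i / a 0) - CU * \<epsilon>..real m * \<epsilon> * (a i / a 0) + CU * \<epsilon>}"
          unfolding A_def x prod.case by (rule Int_lower2)
        show "gamma_density \<phi> \<theta> y \<le> DU" if "y \<in> K \<inter> A m x" for y
          using that R(3)[of y] by (intro DU(2)) (auto simp: A_def x)
        show "real m * \<epsilon> * (a i / a 0) - CU * \<epsilon> \<le> real m * \<epsilon> * (a i / a 0) + CU * \<epsilon>"
          using C_nonneg(1) \<epsilon>(1) by simp
      qed (use DU(1) in simp)
      then show ?thesis
        by simp
    qed
    have B_le: "measure (gamma_measure \<phi>' \<theta>' K) (B m x) \<le> 2 * DV * CV * \<epsilon>" for m x
    proof -
      obtain k j where x: "x = (k, j)"
        by (cases x)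
      have "measure (gamma_measure \<phi>' \<theta>' K) (B m x) \<le> DV * ((a 0 * b j / (real (Suc m) * \<epsilon>) + CV * \<epsilon>)
          - (a 0 * b j / (real (Suc m) * \<epsilon>) - CV * \<epsilon>))"
      proof (rule gamma_measure_le[OF fin(2) K_borel AB_borel(2)])
        show "B m x \<subseteq> {a 0 * b j / (real (Suc m) * \<epsilon>) - CV * \<epsilon>..a 0 * b j / (real (Suc m) * \<epsilon>) + CV * \<epsilon>}"
          unfolding B_def x prod.case by (rule Int_lower2)
        show "gamma_density \<phi>' \<theta>' y \<le> DV" if "y \<in> K \<inter> B m x" for y
          using that R(3)[of y] by (intro DV(2)) (auto simp: B_def x)
        show "a 0 * b j / (real (Suc m) * \<epsilon>) - CV * \<epsilon> \<le> a 0 * b j / (real (Suc m) * \<epsilon>) + CV * \<epsilon>"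
          using C_nonneg(2) \<epsilon>(1) by simp
      qed (use DV(1) in simp)
      then show ?thesis
        by simp
    qed
    have box_measure: "measure P (box m) \<le> E * \<epsilon> ^ (M + N)" for m
    proof -
      have "measure P (box m) = (\<Prod>x\<in>{..<M} \<times> {..<1}. measure (gamma_measure \<phi> \<theta> K) (A m x))
          * (\<Prod>x\<in>{..<1} \<times> {..<N}. measure (gamma_measure \<phi>' \<theta>' K) (B m x))"
        unfolding P_def box_def
        by (rule measure_gamma_matrix_boxes[OF K par]) (rule AB_borel)+
      also have "\<dots> \<le> (\<Prod>x\<in>{..<M} \<times> {..<1::nat}. 2 * DU * CU * \<epsilon>) * (\<Prod>x\<in>{..<1::nat} \<times> {..<N}. 2 * DV * CV * \<epsilon>)"
        using A_le B_le C_nonneg DU(1) \<epsilon>(1) by (intro mult_mono prod_mono prod_nonneg) auto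
      also have "\<dots> = E * \<epsilon> ^ (M + N)"
        by (simp add: E_def power_mult_distrib power_add)
      finally show ?thesis .
    qed
    have cover: "x \<in> (\<Union>m<n. box m)"
      if x: "x \<in> Z" and fst_K: "\<forall>p\<in>{..<M} \<times> {..<1}. fst x p \<in> K" and snd_K: "\<forall>p\<in>{..<1} \<times> {..<N}. snd x p \<in> K"
      for x
    proof -
      have ext: "fst x \<in> {..<M} \<times> {..<1} \<rightarrow>\<^sub>E UNIV" "snd x \<in> {..<1} \<times> {..<N} \<rightarrow>\<^sub>E UNIV"
        using x by (simp_all add: Z_def P_def space_pair_measure space_gamma_matrix_measure mem_Times_iff)
      define u where "u i = fst x (i, 0)" for i :: nat
      define v where "v j = snd x (0, j)" for j :: nat
      have u: "0 \<le> u i" "u i \<le> R" if "i < M" for i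
        using fst_K R(3) that by (auto simp: u_def)
      have v: "0 \<le> v j" "v j \<le> R" if "j < N" for j
        using snd_K R(3) that by (auto simp: v_def)
      have res: "\<bar>u i * v j - a i * b j\<bar> \<le> \<epsilon>" if "i < M" "j < N" for i j
      proof -
        have "\<bar>u i * v j - a i * b j\<bar> \<le> sqrt (nmf_loss M N 1 W x)"
          using residual_le_sqrt_nmf_loss[OF that, where H = 1 and u = "fst x" and v = "snd x" and W = W] W[OF that]
          by (simp add: u_def v_def)
        also have "\<dots> \<le> \<epsilon>"
          unfolding \<epsilon>_def using x by (intro real_sqrt_le_mono) (auto simp: Z_def)
        finally show ?thesis .
      qed
      have uv_ge: "w / 2 \<le> u i * v j" if "i < M" "j < N" for i j
        using res[OF that] w_le[OF that] \<epsilon>(2) by linarith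
      have u_ge: "\<alpha> \<le> u i" if "i < M" for i
      proof -
        have "w / 2 \<le> u i * v 0"
          using uv_ge[OF that, of 0] dims by simp
        also have "\<dots> \<le> u i * R"
          using u(1)[OF that] v(2)[of 0] dims by (intro mult_left_mono) auto
        finally show ?thesis
          using R(2) by (simp add: \<alpha>_def field_simps)
      qed
      have v_ge: "\<alpha> \<le> v j" if "j < N" for j
      proof -
        have "w / 2 \<le> u 0 * v j"
          using uv_ge[OF _ that, of 0] dims by simp
        also have "\<dots> \<le> R * v j"
          using v(1)[OF that] u(2)[of 0] dims by (intro mult_right_mono) auto
        finally show ?thesis
          using R(2) by (simp add: \<alpha>_def field_simps)
      qed
      define m where "m = nat \<lfloor>u 0 / \<epsilon>\<rfloor>"
      have u0: "0 \<le> u 0 / \<epsilon>"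
        using u(1)[of 0] dims \<epsilon>(1) by simp
      have "real m \<le> u 0 / \<epsilon>" "u 0 / \<epsilon> < real m + 1"
        using u0 by (auto simp: m_def)
      then have m: "real m * \<epsilon> \<le> u 0" "u 0 \<le> real (Suc m) * \<epsilon>"
        using \<epsilon>(1) by (auto simp: field_simps)
      have "u 0 / \<epsilon> \<le> R / \<epsilon>"
        using u(2)[of 0] dims \<epsilon>(1) by (intro divide_right_mono) auto
      then have "m < n"
        unfolding m_def n_def by (simp add: less_Suc_eq_le nat_mono floor_mono)
      have "fst x \<in> Pi\<^sub>E ({..<M} \<times> {..<1}) (A m)"
      proof (rule PiE_I)
        fix p assume "p \<in> {..<M} \<times> {..<1::nat}"
        then obtain i where p: "p = (i, 0)" "i < M"
          by auto
        have "\<bar>u i - real m * \<epsilon> * (a i / a 0)\<bar> \<le> CU * \<epsilon>"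
          unfolding CU_def
        proof (rule left_factor_localization[where v = "v 0" and b = "b 0" and u\<^sub>0 = "u 0"])
          show "\<bar>u 0 - real m * \<epsilon>\<bar> \<le> \<epsilon>"
            using m \<epsilon>(1) by (simp add: distrib_right)
        qed (use p dims res v_ge \<rho> a0 a \<open>0 < \<alpha>\<close> in auto)
        then show "fst x p \<in> A m p"
          using u_ge[OF p(2)] by (auto simp: A_def p(1) abs_le_iff u_def)
      next
        fix p assume "p \<notin> {..<M} \<times> {..<1::nat}"
        then show "fst x p = undefined"
          by (rule PiE_arb[OF ext(1)])
      qed
      moreover have "snd x \<in> Pi\<^sub>E ({..<1} \<times> {..<N}) (B m)"
      proof (rule PiE_I)
        fix p assume "p \<in> {..<1::nat} \<times> {..<N}"
        then obtain j where p: "p = (0, j)" "j < N"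
          by auto
        have "\<bar>v j - a 0 * b j / (real (Suc m) * \<epsilon>)\<bar> \<le> CV * \<epsilon>"
          unfolding CV_def
        proof (rule right_factor_localization[where u = "u 0"])
          show "real (Suc m) * \<epsilon> \<le> u 0 + \<epsilon>"
            using m by (simp add: distrib_right)
        qed (use p dims res u_ge \<beta> a0 b \<open>0 < \<alpha>\<close> m in auto)
        then show "snd x p \<in> B m p"
          using v_ge[OF p(2)] by (auto simp: B_def p(1) abs_le_iff v_def)
      next
        fix p assume "p \<notin> {..<1::nat} \<times> {..<N}"
        then show "snd x p = undefined"
          by (rule PiE_arb[OF ext(2)])
      qed
      ultimately have "x \<in> box m"
        by (auto simp: box_def mem_Times_iff)
      then show ?thesis
        using \<open>m < n\<close> by auto
    qed
    have box_sets: "box m \<in> sets P" for m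
      unfolding box_def P_def using AB_borel
      by (intro pair_measureI) (auto simp: sets_gamma_matrix_measure intro!: sets_PiM_I_finite)
    have "measure P Z \<le> measure P (\<Union>m<n. box m)"
    proof (rule P.finite_measure_mono_AE)
      show "AE x in P. x \<in> Z \<longrightarrow> x \<in> (\<Union>m<n. box m)"
        using AE_gamma_pair_measure[OF K par, of M 1 N] unfolding P_def[symmetric]
        by eventually_elim (use cover in blast)
      show "(\<Union>m<n. box m) \<in> sets P"
        using box_sets by auto
    qed
    also have "\<dots> \<le> (\<Sum>m<n. measure P (box m))"
      using box_sets by (intro P.finite_measure_subadditive_finite) auto
    also have "\<dots> \<le> real n * (E * \<epsilon> ^ (M + N))"
      using sum_bounded_above[of "{..<n}" "\<lambda>m. measure P (box m)" "E * \<epsilon> ^ (M + N)"] box_measure by simp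
    also have "\<dots> \<le> (R + 2) / \<epsilon> * (E * \<epsilon> ^ (M + N))"
    proof (intro mult_right_mono)
      have "0 \<le> R / \<epsilon>"
        using R(2) \<epsilon>(1) by simp
      then have "real n \<le> R / \<epsilon> + 1"
        by (simp add: n_def)
      also have "1 \<le> 2 / \<epsilon>"
        using \<epsilon> by simp
      finally show "real n \<le> (R + 2) / \<epsilon>"
        by (simp add: add_divide_distrib)
    qed (use \<open>0 \<le> E\<close> \<epsilon>(1) in auto)
    also have "\<dots> = (R + 2) * E * \<epsilon> powr (real M + real N - 1)"
      using \<epsilon>(1) by (simp add: powr_diff powr_realpow[symmetric])
    also have "\<epsilon> powr (real M + real N - 1) = r powr ((real M + real N - 1) / 2)"
      using r(1) by (simp add: \<epsilon>_def powr_half_sqrt[symmetric] powr_powr)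
    finally show "measure P {x \<in> space P. 0 < nmf_loss M N 1 W x \<and> nmf_loss M N 1 W x \<le> r}
         \<le> (R + 2) * E * r powr ((real M + real N - 1) / 2)"
      by (simp add: Z_def)
  qed
qed


section \<open>The real log canonical threshold\<close>
lemma mats_entry: "A \<in> mats m n C \<Longrightarrow> i < m \<Longrightarrow> j < n \<Longrightarrow> A $$ (i, j) \<in> C"
  by (auto simp: mats_def intro: elements_matI)

lemma mats_mult_entry:
  fixes A B :: "'a :: semiring_0 mat"
  assumes "A \<in> mats m r C" "B \<in> mats r n D" "i < m" "j < n"
  shows "(A * B) $$ (i, j) = (\<Sum>k<r. A $$ (i, k) * B $$ (k, j))"
  using assms by (auto simp: mats_def scalar_prod_def lessThan_atLeast0)


theorem theorem3p1:
  fixes M N H H0 :: nat and K K0 :: "real set" and U0 V0 :: "real mat"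
    and \<phi>\<^sub>U \<theta>\<^sub>U \<phi>\<^sub>V \<theta>\<^sub>V l :: real
  assumes "1 \<le> M" and "1 \<le> N" and "1 \<le> H" and "H0 \<le> H"
    and "compact K" and "K \<subseteq> {0..}"
    and "compact K0" and "K0 \<subseteq> {0<..}"
    and "{(x, y, a, b). x \<in> K \<and> y \<in> K \<and> a \<in> K0 \<and> b \<in> K0 \<and> x * y = a * b} \<noteq> {}"
    and "0 < \<phi>\<^sub>U" and "0 < \<theta>\<^sub>U" and "0 < \<phi>\<^sub>V" and "0 < \<theta>\<^sub>V"
    and "U0 \<in> mats M H0 K0" and "V0 \<in> mats H0 N K0"
    and "nonneg_rank (U0 * V0) = H0"
    and true_in_interior:
      "\<exists>U1 \<in> mats M H0 (interior K). \<exists>V1 \<in> mats H0 N (interior K). U1 * V1 = U0 * V0"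
    and zero_in_interior: "H0 < H \<Longrightarrow> \<exists>\<epsilon>>0. {0..\<epsilon>} \<subseteq> K"
    and rlct: "is_rlct (nmf_zeta M N H K (U0 * V0) (gamma_prior \<phi>\<^sub>U \<theta>\<^sub>U \<phi>\<^sub>V \<theta>\<^sub>V)) l"
  shows "l \<le> 1 / 2 * ((real H - real H0) * min (real M * \<phi>\<^sub>U) (real N * \<phi>\<^sub>V)
                + real H0 * (real M + real N - 1))
    \<and> (H = 1 \<and> H0 = 1 \<longrightarrow>
         l = 1 / 2 * ((real H - real H0) * min (real M * \<phi>\<^sub>U) (real N * \<phi>\<^sub>V)
                + real H0 * (real M + real N - 1)))"
proof
  let ?W = "U0 * V0"
  define P where "P = gamma_matrix_measure M H \<phi>\<^sub>U \<theta>\<^sub>U K \<Otimes>\<^sub>M gamma_matrix_measure H N \<phi>\<^sub>V \<theta>\<^sub>V K"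
  have W: "?W \<in> carrier_mat M N"
    using assms(14,15) by (auto simp: mats_def)
  note K = assms(5,6) and par = assms(10-13)
  have fin: "finite_measure P"
    unfolding P_def using K par by (intro finite_measure_pair_measure finite_gamma_matrix_measure)
  have meas: "nmf_loss M N H ?W \<in> borel_measurable P"
    unfolding P_def by (intro nmf_loss_measurable sets_gamma_matrix_measure)
  obtain B where B: "0 < B" "AE x in P. nmf_loss M N H ?W x \<le> B"
    and zeta: "\<And>z. 0 < Re z \<Longrightarrow> nmf_zeta M N H K ?W (gamma_prior \<phi>\<^sub>U \<theta>\<^sub>U \<phi>\<^sub>V \<theta>\<^sub>V) z
       = (LINT x|P. complex_of_real (nmf_loss M N H ?W x) powr z)"
    by (rule nmf_zeta_eq_integral[OF K W par, of H, folded P_def]) blast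
  define L where "L = 1 / 2 * ((real H - real H0) * min (real M * \<phi>\<^sub>U) (real N * \<phi>\<^sub>V)
                + real H0 * (real M + real N - 1))"
  have "l \<le> L"
  proof -
    obtain U1 V1 where UV: "U1 \<in> mats M H0 (interior K)" "V1 \<in> mats H0 N (interior K)" "U1 * V1 = ?W"
      using true_in_interior by auto
    obtain p q :: nat where pq: "p + q = 1"
      and pq_min: "real p * (real M * \<phi>\<^sub>U) + real q * (real N * \<phi>\<^sub>V) = min (real M * \<phi>\<^sub>U) (real N * \<phi>\<^sub>V)"
    proof (cases "real M * \<phi>\<^sub>U \<le> real N * \<phi>\<^sub>V")
      case True
      then show thesis
        by (intro that[of 1 0]) auto
    next
      case False
      then show thesis
        by (intro that[of 0 1]) auto
    qed
    have entries: "?W $$ (i, j) = (\<Sum>k<H0. U1 $$ (i, k) * V1 $$ (k, j))" if "i < M" "j < N" for i j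
      unfolding UV(3)[symmetric] by (rule mats_mult_entry[OF UV(1,2) that])
    obtain c C where c: "0 < c" "0 < C"
      and lower: "\<And>n. 1 \<le> n \<Longrightarrow>
       c * (1 / real n) powr (real H0 * (real M + real N - 1)
             + (real H - real H0) * (real p * (real M * \<phi>\<^sub>U) + real q * (real N * \<phi>\<^sub>V)))
         \<le> measure P {x \<in> space P. 0 < nmf_loss M N H ?W x \<and> nmf_loss M N H ?W x \<le> C * (1 / real n)\<^sup>2}"
      by (rule volume_lower_bound[OF assms(1-4) K par, of "\<lambda>i k. U1 $$ (i, k)" "\<lambda>k j. V1 $$ (k, j)" ?W p q,
            folded P_def])
         (use mats_entry[OF UV(1)] mats_entry[OF UV(2)] entries zero_in_interior pq in auto)
    define \<eta> where "\<eta> n = C * (1 / real (Suc n))\<^sup>2" for n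
    show ?thesis
    proof (rule is_rlct_le[OF fin meas nmf_loss_nonneg B(2,1) zeta rlct])
      show "0 \<le> L"
        using assms(1,2,4,10,12) by (auto simp: L_def)
      show "0 < \<eta> n" for n
        using c by (simp add: \<eta>_def)
      have "(\<lambda>n. C * (1 / real (Suc n))\<^sup>2) \<longlonglongrightarrow> C * 0\<^sup>2"
        by (intro tendsto_intros LIMSEQ_Suc lim_1_over_n)
      then show "\<eta> \<longlonglongrightarrow> 0"
        by (simp add: \<eta>_def [abs_def])
      show "0 < c / C powr L"
        using c by simp
      fix n
      have square: "(1 / real (Suc n))\<^sup>2 = (1 / real (Suc n)) powr 2"
        by simp
      have "\<eta> n powr L = C powr L * ((1 / real (Suc n)) powr 2) powr L"
        unfolding \<eta>_def square by (rule powr_mult)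
      also have "\<dots> = C powr L * (1 / real (Suc n)) powr (2 * L)"
        by (simp only: powr_powr)
      finally have "\<eta> n powr L = C powr L * (1 / real (Suc n)) powr (2 * L)" .
      then have "c / C powr L * \<eta> n powr L = c * (1 / real (Suc n)) powr (2 * L)"
        using c by simp
      also have "2 * L = real H0 * (real M + real N - 1)
             + (real H - real H0) * (real p * (real M * \<phi>\<^sub>U) + real q * (real N * \<phi>\<^sub>V))"
        unfolding pq_min by (simp add: L_def)
      also note lower[of "Suc n"]
      finally show "c / C powr L * \<eta> n powr L
          \<le> measure P {x \<in> space P. 0 < nmf_loss M N H ?W x \<and> nmf_loss M N H ?W x \<le> \<eta> n}"
        by (simp add: \<eta>_def)
    qed
  qed
  then show "l \<le> 1 / 2 * ((real H - real H0) * min (real M * \<phi>\<^sub>U) (real N * \<phi>\<^sub>V)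
                + real H0 * (real M + real N - 1))"
    by (simp add: L_def)
  show "H = 1 \<and> H0 = 1 \<longrightarrow>
         l = 1 / 2 * ((real H - real H0) * min (real M * \<phi>\<^sub>U) (real N * \<phi>\<^sub>V)
                + real H0 * (real M + real N - 1))"
  proof
    assume "H = 1 \<and> H0 = 1"
    then have [simp]: "H = 1" "H0 = 1"
      by auto
    have pos: "0 < U0 $$ (i, 0)" "0 < V0 $$ (0, j)" if "i < M" "j < N" for i j
      using mats_entry[OF assms(14), of i 0] mats_entry[OF assms(15), of 0 j] that assms(8) by auto
    have entries: "?W $$ (i, j) = U0 $$ (i, 0) * V0 $$ (0, j)" if "i < M" "j < N" for i j
      using mats_mult_entry[OF assms(14,15) that] by simp
    have pos_U: "0 < U0 $$ (i, 0)" if "i < M" for i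
      using pos[OF that, of 0] assms(2) by simp
    have pos_V: "0 < V0 $$ (0, j)" if "j < N" for j
      using pos[OF _ that, of 0] assms(1) by simp
    have P_eq: "P = gamma_matrix_measure M 1 \<phi>\<^sub>U \<theta>\<^sub>U K \<Otimes>\<^sub>M gamma_matrix_measure 1 N \<phi>\<^sub>V \<theta>\<^sub>V K"
      by (simp add: P_def)
    have "(real M + real N - 1) / 2 \<le> l"
    proof (rule volume_upper_bound_rank_one[OF assms(1,2) K par, of "\<lambda>i. U0 $$ (i, 0)" "\<lambda>j. V0 $$ (0, j)" ?W,
          OF pos_U pos_V entries, folded P_eq])
      fix C \<eta> :: real
      assume "0 < \<eta>"
        and upper: "\<And>r. 0 < r \<Longrightarrow> r \<le> \<eta> \<Longrightarrow>
          measure P {x \<in> space P. 0 < nmf_loss M N 1 ?W x \<and> nmf_loss M N 1 ?W x \<le> r}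
            \<le> C * r powr ((real M + real N - 1) / 2)"
      show ?thesis
      proof (rule is_rlct_ge[OF fin meas nmf_loss_nonneg B(2,1) zeta rlct _ \<open>0 < \<eta>\<close>])
        show "0 < (real M + real N - 1) / 2"
          using assms(1,2) by simp
        show "measure P {x \<in> space P. 0 < nmf_loss M N H ?W x \<and> nmf_loss M N H ?W x \<le> r}
            \<le> C * r powr ((real M + real N - 1) / 2)" if "0 < r" "r \<le> \<eta>" for r
          unfolding \<open>H = 1\<close> using that by (rule upper)
      qed
    qed
    then show "l = 1 / 2 * ((real H - real H0) * min (real M * \<phi>\<^sub>U) (real N * \<phi>\<^sub>V)
                + real H0 * (real M + real N - 1))"
      using \<open>l \<le> L\<close> by (simp add: L_def)
  qed
qed

end
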